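(* Let $\Bbbk$ be a subfield of $\mathbb{C}$ and $A$ a positively based $\Bbbk$-algebra of finite dimension $n$ with positive basis $\mathbf{B}=\{a_1,\dots,a_n\}$. Let $\mathcal{L}$ be a left cell in $\mathbf{n}$. Then for any $\mathbf{c},\mathbf{c}'\in(\mathbb{R}_{>0}\cap\Bbbk)^n$ there is an isomorphism of $A$-modules $L_{\mathcal{L},\mathbf{c}}\cong L_{\mathcal{L},\mathbf{c}'}$.
   Context: Positively based algebra: $A$ is a unital associative $\Bbbk$-algebra with a fixed basis $\mathbf{B}=\{a_1,\dots,a_n\}$ such that $a_ia_j=\sum_{k}\gamma_{i,j}^{(k)}a_k$ with all $\gamma_{i,j}^{(k)}\in\mathbb{R}_{\ge 0}$; it is assumed that $a_1$ is the unit of $A$. Modules are left modules. Cells: put $\mathbf{n}=\{1,\dots,n\}$ and $i\star j=\{k:\gamma_{i,j}^{(k)}>0\}$. Write $i\le_L j$ if $j\in s\star i$ for some $s\in\mathbf{n}$; this is a preorder. Write $i\sim_L j$ if $i\le_L j$ and $j\le_L i$. The equivalence classes of $\sim_L$ are the left cells, and $\le_L$ induces a partial order on them. Cell module: for a left cell $\mathcal{L}$, let $\overline{\mathcal{L}}$ be the union of all left cells $\mathcal{L}'$ with $\mathcal{L}'\ge_L\mathcal{L}$. Let $M_{\mathcal{L}}$ be the span of all $a_j$, $j\in\overline{\mathcal{L}}$, and $N_{\mathcal{L}}$ the span of all $a_j$, $j\in\overline{\mathcal{L}}\setminus\mathcal{L}$; these are $A$-submodules of ${}_AA$. Set $C_{\mathcal{L}}=M_{\mathcal{L}}/N_{\mathcal{L}}$,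 with basis $\mathbf{B}_{\mathcal{L}}$ given by the images of $a_i$, $i\in\mathcal{L}$. Special subquotient: for $\mathbf{c}=(c_1,\dots,c_n)\in(\mathbb{R}_{>0}\cap\Bbbk)^n$ put $a(\mathbf{c})=\sum_i c_ia_i$. The matrix of $a(\mathbf{c})$ on $C_{\mathcal{L}}$ in the basis $\mathbf{B}_{\mathcal{L}}$ has positive real entries; let $\lambda$ be its Perron-Frobenius eigenvalue (the positive real eigenvalue, of algebraic multiplicity one, that is strictly larger than the absolute value of any other eigenvalue). Then $L_{\mathcal{L},\mathbf{c}}$ denotes the simple subquotient (composition factor) of $C_{\mathcal{L}}$, unique up to isomorphism and of composition multiplicity one, such that $\lambda$ is an eigenvalue of $a(\mathbf{c})$ acting on it. *)

theory Defs
  imports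
    "HOL-Algebra.Subrings"
    "Jordan_Normal_Form.VS_Connect"
    "Jordan_Normal_Form.Char_Poly"
begin

section \<open>Modules over a non-commutative ring\<close>

text \<open>
  A left module over a ring \<open>A\<close> is represented by the record type \<^typ>\<open>('a, 'm) module\<close>;
  the library predicate \<^const>\<open>module\<close> is only available for commutative \<open>A\<close>, but
  \<^const>\<open>Module.submodule\<close> and \<^const>\<open>module_hom\<close> carry no such restriction.
  The fields \<open>mult\<close> and \<open>one\<close> of such a record have no meaning.
\<close>

definition regular_module :: "('k, 'a) module \<Rightarrow> ('a, 'a) module" where
  "regular_module A =
     \<lparr>carrier = carrier A, monoid.mult = monoid.mult A, one = one A, zero = zero A,
      add = add A, module.smult = monoid.mult A\<rparr>"

definition quotient_module :: "('a, 'm) module \<Rightarrow> 'm set \<Rightarrow> ('a, 'm set) module" where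
  "quotient_module M N =
     \<lparr>carrier = a_rcosets\<^bsub>M\<^esub> N, monoid.mult = (\<lambda>X Y. N), one = N, zero = N, add = set_add M,
      module.smult = (\<lambda>r X. \<Union>x\<in>X. N +>\<^bsub>M\<^esub> (r \<odot>\<^bsub>M\<^esub> x))\<rparr>"

definition simple_module :: "('k, 'a) module \<Rightarrow> ('a, 'm) module \<Rightarrow> bool" where
  "simple_module A M \<longleftrightarrow>
     carrier M \<noteq> {\<zero>\<^bsub>M\<^esub>} \<and>
     (\<forall>H. Module.submodule H A M \<longrightarrow> H = {\<zero>\<^bsub>M\<^esub>} \<or> H = carrier M)"

definition subquotient :: "('k, 'a) module \<Rightarrow> ('a, 'm) module \<Rightarrow> ('a, 'm set) module \<Rightarrow> bool" where
  "subquotient A M X \<longleftrightarrow>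
     (\<exists>P Q. Module.submodule P A M \<and> Module.submodule Q A M \<and> Q \<subseteq> P \<and>
            X = quotient_module (M\<lparr>carrier := P\<rparr>) Q)"

definition isomorphic_modules ::
    "('k, 'a) module \<Rightarrow> ('a, 'm) module \<Rightarrow> ('a, 'l) module \<Rightarrow> bool" where
  "isomorphic_modules A M N \<longleftrightarrow>
     (\<exists>f \<in> module_hom A M N. bij_betw f (carrier M) (carrier N))"


section \<open>Algebras over a subfield of the complex numbers\<close>

abbreviation scalars :: "complex set \<Rightarrow> complex ring" where
  "scalars \<k> \<equiv> class_ring\<lparr>carrier := \<k>\<rparr>"

locale unital_algebra =
  fixes \<k> :: "complex set" and A :: "(complex, 'a) module" (structure)
  assumes subfield: "subfield \<k> class_ring"
    and vectorspace: "vectorspace (scalars \<k>) A"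
    and ring: "ring A"
    and smult_mult: "\<lbrakk>\<kappa> \<in> \<k>; x \<in> carrier A; y \<in> carrier A\<rbrakk>
      \<Longrightarrow> (\<kappa> \<odot> x) \<otimes> y = \<kappa> \<odot> (x \<otimes> y)"
    and mult_smult: "\<lbrakk>\<kappa> \<in> \<k>; x \<in> carrier A; y \<in> carrier A\<rbrakk>
      \<Longrightarrow> x \<otimes> (\<kappa> \<odot> y) = \<kappa> \<odot> (x \<otimes> y)"

locale positively_based_algebra = unital_algebra \<k> A
  for \<k> :: "complex set" and A :: "(complex, 'a) module" (structure) +
  fixes n :: nat and a :: "nat \<Rightarrow> 'a" and \<gamma> :: "nat \<Rightarrow> nat \<Rightarrow> nat \<Rightarrow> real"
  assumes n_pos: "1 \<le> n"
    and inj: "inj_on a {1..n}"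
    and basis: "vectorspace.basis (scalars \<k>) A (a ` {1..n})"
    and unit: "a 1 = \<one>"
    and gamma_nonneg: "\<lbrakk>i \<in> {1..n}; j \<in> {1..n}; k \<in> {1..n}\<rbrakk> \<Longrightarrow> 0 \<le> \<gamma> i j k"
    and gamma_scalar: "\<lbrakk>i \<in> {1..n}; j \<in> {1..n}; k \<in> {1..n}\<rbrakk> \<Longrightarrow> complex_of_real (\<gamma> i j k) \<in> \<k>"
    and structure_constants: "\<lbrakk>i \<in> {1..n}; j \<in> {1..n}\<rbrakk>
      \<Longrightarrow> a i \<otimes> a j = (\<Oplus>k\<in>{1..n}. complex_of_real (\<gamma> i j k) \<odot> a k)"

text \<open>
  The underlying \<open>\<k>\<close>-vector space of an \<open>A\<close>-module: a scalar acts through its multiple of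
  the unit of \<open>A\<close>.
\<close>

definition underlying_space :: "('k, 'a) module \<Rightarrow> ('a, 'm) module \<Rightarrow> ('k, 'm) module" where
  "underlying_space A M =
     \<lparr>carrier = carrier M, monoid.mult = monoid.mult M, one = one M, zero = zero M, add = add M,
      module.smult = (\<lambda>\<kappa> x. (\<kappa> \<odot>\<^bsub>A\<^esub> \<one>\<^bsub>A\<^esub>) \<odot>\<^bsub>M\<^esub> x)\<rparr>"

definition ordered_basis ::
    "complex set \<Rightarrow> (complex, 'a) module \<Rightarrow> ('a, 'm) module \<Rightarrow> 'm list \<Rightarrow> bool" where
  "ordered_basis \<k> A M bs \<longleftrightarrow>
     distinct bs \<and> vectorspace.basis (scalars \<k>) (underlying_space A M) (set bs)"

text \<open>\<open>D\<close> is the matrix of the action of \<open>r\<close> on \<open>M\<close>; its \<open>j\<close>-th column holds the coordinates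
  of \<open>r \<odot> bs ! j\<close>.\<close>

definition action_matrix ::
    "complex set \<Rightarrow> (complex, 'a) module \<Rightarrow> ('a, 'm) module \<Rightarrow> 'm list \<Rightarrow> 'a \<Rightarrow> complex mat \<Rightarrow> bool"
  where
  "action_matrix \<k> A M bs r D \<longleftrightarrow>
     ordered_basis \<k> A M bs \<and>
     D \<in> carrier_mat (length bs) (length bs) \<and> elements_mat D \<subseteq> \<k> \<and>
     (\<forall>j<length bs. r \<odot>\<^bsub>M\<^esub> bs ! j =
        (\<Oplus>\<^bsub>underlying_space A M\<^esub> i\<in>{..<length bs}. D $$ (i, j) \<odot>\<^bsub>underlying_space A M\<^esub> bs ! i))"

text \<open>Eigenvalues are complex numbers and need not lie in \<open>\<k>\<close>; by base change they do not depend
  on the chosen basis.\<close>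

definition action_eigenvalue ::
    "complex set \<Rightarrow> (complex, 'a) module \<Rightarrow> ('a, 'm) module \<Rightarrow> 'a \<Rightarrow> complex \<Rightarrow> bool" where
  "action_eigenvalue \<k> A M r \<nu> \<longleftrightarrow> (\<exists>bs D. action_matrix \<k> A M bs r D \<and> eigenvalue D \<nu>)"

definition perron_frobenius_eigenvalue :: "complex mat \<Rightarrow> real \<Rightarrow> bool" where
  "perron_frobenius_eigenvalue D \<mu> \<longleftrightarrow>
     0 < \<mu> \<and> eigenvalue D (complex_of_real \<mu>) \<and>
     order (complex_of_real \<mu>) (char_poly D) = 1 \<and>
     (\<forall>\<nu>. eigenvalue D \<nu> \<and> \<nu> \<noteq> complex_of_real \<mu> \<longrightarrow> cmod \<nu> < \<mu>)"


section \<open>Left cells\<close>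

definition star_product :: "nat \<Rightarrow> (nat \<Rightarrow> nat \<Rightarrow> nat \<Rightarrow> real) \<Rightarrow> nat \<Rightarrow> nat \<Rightarrow> nat set" where
  "star_product n \<gamma> i j = {k \<in> {1..n}. 0 < \<gamma> i j k}"

definition left_le :: "nat \<Rightarrow> (nat \<Rightarrow> nat \<Rightarrow> nat \<Rightarrow> real) \<Rightarrow> nat \<Rightarrow> nat \<Rightarrow> bool" where
  "left_le n \<gamma> i j \<longleftrightarrow> (\<exists>s\<in>{1..n}. j \<in> star_product n \<gamma> s i)"

definition left_equiv :: "nat \<Rightarrow> (nat \<Rightarrow> nat \<Rightarrow> nat \<Rightarrow> real) \<Rightarrow> (nat \<times> nat) set" where
  "left_equiv n \<gamma> = {(i, j) \<in> {1..n} \<times> {1..n}. left_le n \<gamma> i j \<and> left_le n \<gamma> j i}"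

definition left_cells :: "nat \<Rightarrow> (nat \<Rightarrow> nat \<Rightarrow> nat \<Rightarrow> real) \<Rightarrow> nat set set" where
  "left_cells n \<gamma> = {1..n} // left_equiv n \<gamma>"

definition cell_le :: "nat \<Rightarrow> (nat \<Rightarrow> nat \<Rightarrow> nat \<Rightarrow> real) \<Rightarrow> nat set \<Rightarrow> nat set \<Rightarrow> bool" where
  "cell_le n \<gamma> L L' \<longleftrightarrow> (\<exists>i\<in>L. \<exists>j\<in>L'. left_le n \<gamma> i j)"

definition upper_cells :: "nat \<Rightarrow> (nat \<Rightarrow> nat \<Rightarrow> nat \<Rightarrow> real) \<Rightarrow> nat set \<Rightarrow> nat set" where
  "upper_cells n \<gamma> L = \<Union>{L' \<in> left_cells n \<gamma>. cell_le n \<gamma> L L'}"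


section \<open>Cell modules and their special subquotients\<close>

definition basis_span :: "complex set \<Rightarrow> (complex, 'a) module \<Rightarrow> (nat \<Rightarrow> 'a) \<Rightarrow> nat set \<Rightarrow> 'a set" where
  "basis_span \<k> A a J = module.span (scalars \<k>) A (a ` J)"

definition cell_module ::
    "complex set \<Rightarrow> (complex, 'a) module \<Rightarrow> nat \<Rightarrow> (nat \<Rightarrow> 'a) \<Rightarrow> (nat \<Rightarrow> nat \<Rightarrow> nat \<Rightarrow> real) \<Rightarrow>
     nat set \<Rightarrow> ('a, 'a set) module" where
  "cell_module \<k> A n a \<gamma> L =
     quotient_module
       ((regular_module A)\<lparr>carrier := basis_span \<k> A a (upper_cells n \<gamma> L)\<rparr>)
       (basis_span \<k> A a (upper_cells n \<gamma> L - L))"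

definition cell_basis ::
    "complex set \<Rightarrow> (complex, 'a) module \<Rightarrow> nat \<Rightarrow> (nat \<Rightarrow> 'a) \<Rightarrow> (nat \<Rightarrow> nat \<Rightarrow> nat \<Rightarrow> real) \<Rightarrow>
     nat set \<Rightarrow> 'a set list" where
  "cell_basis \<k> A n a \<gamma> L =
     map (\<lambda>i. basis_span \<k> A a (upper_cells n \<gamma> L - L) +>\<^bsub>A\<^esub> a i) (sorted_list_of_set L)"

definition positive_element ::
    "(complex, 'a) module \<Rightarrow> nat \<Rightarrow> (nat \<Rightarrow> 'a) \<Rightarrow> (nat \<Rightarrow> real) \<Rightarrow> 'a" where
  "positive_element A n a c = (\<Oplus>\<^bsub>A\<^esub> i\<in>{1..n}. complex_of_real (c i) \<odot>\<^bsub>A\<^esub> a i)"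

text \<open>\<open>X\<close> is one of the (mutually isomorphic) concrete subquotients of the cell module that
  represent the special subquotient attached to the cell \<open>L\<close> and the coefficients \<open>c\<close>.\<close>

definition special_subquotient ::
    "complex set \<Rightarrow> (complex, 'a) module \<Rightarrow> nat \<Rightarrow> (nat \<Rightarrow> 'a) \<Rightarrow> (nat \<Rightarrow> nat \<Rightarrow> nat \<Rightarrow> real) \<Rightarrow>
     nat set \<Rightarrow> (nat \<Rightarrow> real) \<Rightarrow> ('a, 'a set set) module \<Rightarrow> bool" where
  "special_subquotient \<k> A n a \<gamma> L c X \<longleftrightarrow>
     subquotient A (cell_module \<k> A n a \<gamma> L) X \<and> simple_module A X \<and>
     (\<exists>D \<mu>. action_matrix \<k> A (cell_module \<k> A n a \<gamma> L) (cell_basis \<k> A n a \<gamma> L)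
              (positive_element A n a c) D \<and>
            perron_frobenius_eigenvalue D \<mu> \<and>
            action_eigenvalue \<k> A X (positive_element A n a c) (complex_of_real \<mu>))"

end

theory Submission
  imports Defs "Jordan_Normal_Form.Spectral_Radius"
begin

text \<open>
  Let \<open>C\<close> be the cell module of \<open>L\<close>. Since any two elements of \<open>L\<close> are comparable for \<open>\<le>\<^sub>L\<close>, the
  element \<open>a(c)\<close> acts on \<open>C\<close>, in the cell basis, by a matrix \<open>D\<close> with positive entries. Let \<open>\<lambda>\<close> be its
  Perron-Frobenius eigenvalue, \<open>v\<close> and \<open>w\<close> positive right and left eigenvectors, and \<open>W\<close> the functional
  on \<open>C\<close> with coordinate vector \<open>w\<close>, so that \<open>W (a(c) x) = \<lambda> W x\<close>. The eigenvalue \<open>\<lambda>\<close> need not lie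
  in \<open>\<k>\<close>; instead of extending scalars to the complex numbers, the proof works with complex-valued
  \<open>\<k>\<close>-linear functionals on \<open>\<k>\<close>-subspaces of \<open>C\<close>.

  The heart of the matter is that \<open>W\<close> is the only eigenfunctional, even on submodules: if \<open>P\<close> is a
  submodule of \<open>C\<close> and \<open>\<phi>\<close> is \<open>\<k>\<close>-linear on \<open>P\<close> with \<open>\<phi> (a(c) x) = \<lambda> \<phi> x\<close>, then \<open>\<phi> = t W\<close> on \<open>P\<close>.
  Indeed \<open>\<phi>\<close> is given by some complex coordinate vector \<open>f\<close> (\<open>functional_in_coordinates\<close>), and
  \<open>\<phi> x = \<lambda>\<^sup>-\<^sup>k \<phi> (a(c)\<^sup>k x)\<close> tends to \<open>(f \<cdot> v) W x\<close>, because \<open>\<lambda>\<^sup>-\<^sup>k D\<^sup>k\<close> converges to the projection \<open>v w\<^sup>T\<close>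
  (\<open>eigenfunctional_multiple\<close>, with the convergence coming from
  \<open>positive_matrix_contraction\<close>). Three consequences yield the theorem.

  \<^item> If \<open>\<lambda>\<close> is an eigenvalue of \<open>a(c)\<close> on \<open>P / Q\<close>, then a left eigenvector of the matrix of this action
    is an eigenfunctional on \<open>P\<close> that kills \<open>Q\<close>. Hence \<open>W\<close> vanishes on \<open>Q\<close> but not on \<open>P\<close>
    (\<open>dominant_functional_on_subquotient\<close>).

  \<^item> Whether \<open>W\<close> vanishes on a submodule \<open>P\<close> does not depend on \<open>c\<close>. If the functional \<open>W'\<close> belonging
    to \<open>c'\<close> vanishes on \<open>P\<close>, it is trivially an eigenfunctional of \<open>a(c)\<close> there, so
    \<open>0 = (w' \<cdot> v) W x\<close> for \<open>x \<in> P\<close>, and \<open>w' \<cdot> v > 0\<close> (\<open>perron_functional\<close>). So a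
    subquotient that is special for \<open>c'\<close> satisfies the criterion of the first item for \<open>c\<close>.

  \<^item> Two simple subquotients \<open>P / Q\<close> and \<open>P' / Q'\<close> for which \<open>W\<close> vanishes on \<open>Q\<close> and \<open>Q'\<close> but not on
    \<open>P\<close> and \<open>P'\<close> are isomorphic. First, \<open>W\<close> does not vanish on \<open>R = P \<inter> P'\<close>: otherwise
    \<open>x + x' \<mapsto> W x\<close> would be an eigenfunctional on \<open>P + P'\<close> that is not a multiple of \<open>W\<close>
    (\<open>dominant_functional_inter\<close>). By simplicity \<open>R\<close> then maps onto both quotients, with the same
    kernel (\<open>special_subquotients_isomorphic\<close>).
\<close>
section \<open>Perron-Frobenius eigenvectors of positive matrices\<close>

lemma eigenvalue_coordinates:
  fixes D :: "complex mat"
  assumes D: "D \<in> carrier_mat m m"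
  shows "eigenvalue D \<nu> \<longleftrightarrow>
    (\<exists>z. (\<exists>i<m. z i \<noteq> 0) \<and> (\<forall>i<m. (\<Sum>j<m. D $$ (i, j) * z j) = \<nu> * z i))"
proof
  assume "eigenvalue D \<nu>"
  then obtain x where x: "x \<in> carrier_vec m" "x \<noteq> 0\<^sub>v m" "D *\<^sub>v x = \<nu> \<cdot>\<^sub>v x"
    using D unfolding eigenvalue_def eigenvector_def by auto
  have "\<exists>i<m. x $ i \<noteq> 0"
    using x by (metis carrier_vecD eq_vecI index_zero_vec(1) zero_carrier_vec)
  moreover have "(\<Sum>j<m. D $$ (i, j) * x $ j) = \<nu> * x $ i" if "i < m" for i
  proof -
    have "(\<Sum>j<m. D $$ (i, j) * x $ j) = (D *\<^sub>v x) $ i"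
      using D x(1) that by (auto simp: scalar_prod_def lessThan_atLeast0)
    thus ?thesis using x that by simp
  qed
  ultimately show "\<exists>z. (\<exists>i<m. z i \<noteq> 0) \<and> (\<forall>i<m. (\<Sum>j<m. D $$ (i, j) * z j) = \<nu> * z i)"
    by (intro exI[of _ "\<lambda>i. x $ i"]) blast
next
  assume "\<exists>z. (\<exists>i<m. z i \<noteq> 0) \<and> (\<forall>i<m. (\<Sum>j<m. D $$ (i, j) * z j) = \<nu> * z i)"
  then obtain z where z: "\<exists>i<m. z i \<noteq> 0" "\<forall>i<m. (\<Sum>j<m. D $$ (i, j) * z j) = \<nu> * z i"
    by blast
  have "vec m z \<noteq> 0\<^sub>v m"
    using z(1) by (metis index_vec index_zero_vec(1))
  moreover have "D *\<^sub>v vec m z = \<nu> \<cdot>\<^sub>v vec m z"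
    using z(2) D by (intro eq_vecI) (auto simp: scalar_prod_def lessThan_atLeast0)
  ultimately show "eigenvalue D \<nu>"
    using D unfolding eigenvalue_def eigenvector_def by (intro exI[of _ "vec m z"]) auto
qed

text \<open>
  Both matrices have the same characteristic polynomial.
\<close>

lemma eigenvalue_transpose:
  fixes D :: "complex mat"
  assumes D: "D \<in> carrier_mat m m"
  shows "eigenvalue (transpose_mat D) \<nu> \<longleftrightarrow> eigenvalue D \<nu>"
  using D eigenvalue_root_char_poly[OF D] eigenvalue_root_char_poly[of "transpose_mat D" m]
  by simp

lemma left_eigenvector_exists:
  fixes D :: "complex mat"
  assumes D: "D \<in> carrier_mat m m" and ev: "eigenvalue D \<nu>"
  obtains f where "\<exists>i<m. f i \<noteq> 0" "\<And>j. j < m \<Longrightarrow> (\<Sum>i<m. f i * D $$ (i, j)) = \<nu> * f j"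
proof -
  have T: "transpose_mat D \<in> carrier_mat m m" using D by simp
  have "eigenvalue (transpose_mat D) \<nu>" using ev eigenvalue_transpose[OF D] by simp
  then obtain z where z: "\<exists>i<m. z i \<noteq> 0"
    "\<forall>j<m. (\<Sum>i<m. transpose_mat D $$ (j, i) * z i) = \<nu> * z j"
    using eigenvalue_coordinates[OF T] by blast
  have "(\<Sum>i<m. z i * D $$ (i, j)) = \<nu> * z j" if "j < m" for j
    using z(2) that D by (auto simp: mult.commute)
  thus thesis using that z(1) by blast
qed

text \<open>
  If \<open>\<rho>\<close> exceeded \<open>\<mu>\<close>, choose \<open>\<sigma>\<close> strictly between them. The matrix \<open>B = D / \<sigma>\<close> has spectral radius below one, so
  its powers are bounded, whereas \<open>D y \<ge> \<rho> y\<close> iterates to \<open>B\<^sup>k y \<ge> (\<rho> / \<sigma>)\<^sup>k y\<close>, which is unbounded.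
\<close>

lemma subinvariance_bound:
  fixes D :: "complex mat" and y :: "nat \<Rightarrow> real"
  assumes D: "D \<in> carrier_mat m m"
    and real: "\<And>i j. i < m \<Longrightarrow> j < m \<Longrightarrow> D $$ (i, j) = complex_of_real (d i j)"
    and nonneg: "\<And>i j. i < m \<Longrightarrow> j < m \<Longrightarrow> 0 \<le> d i j"
    and bound: "\<And>\<nu>. eigenvalue D \<nu> \<Longrightarrow> cmod \<nu> \<le> \<mu>" and mu: "0 \<le> \<mu>"
    and m: "0 < m" and y: "\<And>i. i < m \<Longrightarrow> 0 < y i"
    and sub: "\<And>i. i < m \<Longrightarrow> \<rho> * y i \<le> (\<Sum>j<m. d i j * y j)"
  shows "\<rho> \<le> \<mu>"
proof (rule ccontr)
  assume "\<not> \<rho> \<le> \<mu>"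
  define \<sigma> where "\<sigma> = (\<mu> + \<rho>) / 2"
  have s: "\<mu> < \<sigma>" "\<sigma> < \<rho>" "0 < \<sigma>"
    using \<open>\<not> \<rho> \<le> \<mu>\<close> mu by (auto simp: \<sigma>_def)
  define B where "B = complex_of_real (1 / \<sigma>) \<cdot>\<^sub>m D"
  have B: "B \<in> carrier_mat m m" using D by (simp add: B_def)
  have Bij: "B $$ (i, j) = complex_of_real (d i j / \<sigma>)" if "i < m" "j < m" for i j
    using that D by (simp add: B_def real)
  have "spectral_radius B < 1"
  proof -
    obtain b where b: "b \<in> spectrum B" "spectral_radius B = norm b"
      using spectral_radius_mem_max(1)[OF B m] by auto
    then obtain z where z: "\<exists>i<m. z i \<noteq> 0" "\<forall>i<m. (\<Sum>j<m. B $$ (i, j) * z j) = b * z i"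
      using eigenvalue_coordinates[OF B] unfolding spectrum_def by blast
    have "(\<Sum>j<m. D $$ (i, j) * z j) = (complex_of_real \<sigma> * b) * z i" if i: "i < m" for i
    proof -
      have "(\<Sum>j<m. D $$ (i, j) * z j) = complex_of_real \<sigma> * (\<Sum>j<m. B $$ (i, j) * z j)"
        unfolding sum_distrib_left using i D s(3)
        by (intro sum.cong) (auto simp: B_def)
      thus ?thesis using z(2) i by simp
    qed
    hence "eigenvalue D (complex_of_real \<sigma> * b)"
      using z(1) eigenvalue_coordinates[OF D] by blast
    from bound[OF this] have "\<sigma> * norm b \<le> \<mu>"
      using s by (simp add: norm_mult)
    hence "\<sigma> * norm b < \<sigma> * 1" using s by linarith
    thus ?thesis using s(3) b(2) by (simp only: mult_less_cancel_left_pos)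
  qed
  then obtain C where C: "\<And>k. norm_bound (B ^\<^sub>m k) C"
    using spectral_radius_jnf_norm_bound_less_1_upper_triangular[OF B] by blast
  have grow: "\<exists>u. (\<forall>i<m. \<forall>j<m. (B ^\<^sub>m k) $$ (i, j) = complex_of_real (u i j) \<and> 0 \<le> u i j) \<and>
      (\<forall>i<m. (\<rho> / \<sigma>) ^ k * y i \<le> (\<Sum>j<m. u i j * y j))" for k
  proof (induction k)
    case 0
    have "(\<Sum>j<m. (if i = j then 1 else 0) * y j) = (\<Sum>j<m. if i = j then y j else 0)" for i
      by (intro sum.cong) auto
    thus ?case
      using B by (intro exI[of _ "\<lambda>i j. if i = j then 1 else 0"]) auto
  next
    case (Suc k)
    then obtain u where u: "\<And>i j. i < m \<Longrightarrow> j < m \<Longrightarrow> (B ^\<^sub>m k) $$ (i, j) = complex_of_real (u i j)"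
      "\<And>i j. i < m \<Longrightarrow> j < m \<Longrightarrow> 0 \<le> u i j"
      "\<And>i. i < m \<Longrightarrow> (\<rho> / \<sigma>) ^ k * y i \<le> (\<Sum>j<m. u i j * y j)" by blast
    define u' where "u' i j = (\<Sum>l<m. u i l * (d l j / \<sigma>))" for i j
    have "(B ^\<^sub>m Suc k) $$ (i, j) = complex_of_real (u' i j)" if "i < m" "j < m" for i j
    proof -
      have "(B ^\<^sub>m Suc k) $$ (i, j) = (\<Sum>l<m. (B ^\<^sub>m k) $$ (i, l) * B $$ (l, j))"
        using that B by (auto simp: scalar_prod_def lessThan_atLeast0)
      also have "\<dots> = (\<Sum>l<m. complex_of_real (u i l * (d l j / \<sigma>)))"
        using that by (intro sum.cong refl) (simp add: u(1) Bij)
      finally show ?thesis by (simp add: u'_def)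
    qed
    moreover have "0 \<le> u' i j" if "i < m" "j < m" for i j
      unfolding u'_def using that u(2) nonneg s(3) by (intro sum_nonneg mult_nonneg_nonneg) auto
    moreover have "(\<rho> / \<sigma>) ^ Suc k * y i \<le> (\<Sum>j<m. u' i j * y j)" if i: "i < m" for i
    proof -
      have "(\<rho> / \<sigma>) ^ Suc k * y i = (\<rho> / \<sigma>) * ((\<rho> / \<sigma>) ^ k * y i)" by simp
      also have "\<dots> \<le> (\<rho> / \<sigma>) * (\<Sum>l<m. u i l * y l)"
        using u(3)[OF i] s mu by (intro mult_left_mono) auto
      also have "\<dots> = (\<Sum>l<m. u i l * (\<rho> * y l / \<sigma>))"
        unfolding sum_distrib_left by (intro sum.cong) auto
      also have "\<dots> \<le> (\<Sum>l<m. u i l * ((\<Sum>j<m. d l j * y j) / \<sigma>))"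
        using sub u(2) i s(3) by (intro sum_mono mult_left_mono divide_right_mono) auto
      also have "\<dots> = (\<Sum>l<m. \<Sum>j<m. u i l * (d l j / \<sigma>) * y j)"
        by (simp add: sum_distrib_left sum_divide_distrib mult.assoc)
      also have "\<dots> = (\<Sum>j<m. u' i j * y j)"
        unfolding u'_def sum_distrib_right by (rule sum.swap)
      finally show ?thesis .
    qed
    ultimately show ?case by blast
  qed
  have le: "(\<rho> / \<sigma>) ^ k * y 0 \<le> C * (\<Sum>j<m. y j)" for k
  proof -
    obtain u where "(\<forall>i<m. \<forall>j<m. (B ^\<^sub>m k) $$ (i, j) = complex_of_real (u i j) \<and> 0 \<le> u i j) \<and>
        (\<forall>i<m. (\<rho> / \<sigma>) ^ k * y i \<le> (\<Sum>j<m. u i j * y j))"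
      using grow[of k] by (elim exE)
    hence u: "\<And>i j. i < m \<Longrightarrow> j < m \<Longrightarrow> (B ^\<^sub>m k) $$ (i, j) = complex_of_real (u i j)"
      "\<And>i j. i < m \<Longrightarrow> j < m \<Longrightarrow> 0 \<le> u i j"
      "\<And>i. i < m \<Longrightarrow> (\<rho> / \<sigma>) ^ k * y i \<le> (\<Sum>j<m. u i j * y j)" by auto
    have "u 0 j \<le> C" if "j < m" for j
    proof -
      have "norm ((B ^\<^sub>m k) $$ (0, j)) \<le> C"
        using C[of k] that m B pow_carrier_mat[OF B, of k] unfolding norm_bound_def by auto
      thus ?thesis using u(1,2)[OF m that] by simp
    qed
    hence "(\<Sum>j<m. u 0 j * y j) \<le> (\<Sum>j<m. C * y j)"
      using y by (intro sum_mono mult_right_mono) (auto intro: less_imp_le)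
    thus ?thesis using u(3)[OF m] by (simp add: sum_distrib_left)
  qed
  obtain k where "C * (\<Sum>j<m. y j) / y 0 < (\<rho> / \<sigma>) ^ k"
    using real_arch_pow[of "\<rho> / \<sigma>"] s by auto
  thus False using le[of k] y[OF m] by (simp add: field_simps)
qed

text \<open>
  Let \<open>z\<close> be a complex eigenvector and \<open>u = |z|\<close> entrywise. The triangle inequality gives
  \<open>y = D u \<ge> \<mu> u\<close>. If some entry were strict, positivity of \<open>D\<close> would make \<open>D y > \<mu> y\<close> strict in every
  entry, hence \<open>D y \<ge> \<rho> y\<close> for some \<open>\<rho> > \<mu>\<close>, against \<open>subinvariance_bound\<close>. So \<open>u\<close> itself is an
  eigenvector, and it is positive because \<open>D u\<close> is.
\<close>

lemma positive_eigenvector: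
  fixes D :: "complex mat"
  assumes D: "D \<in> carrier_mat m m"
    and real: "\<And>i j. i < m \<Longrightarrow> j < m \<Longrightarrow> D $$ (i, j) = complex_of_real (d i j)"
    and pos: "\<And>i j. i < m \<Longrightarrow> j < m \<Longrightarrow> 0 < d i j"
    and mu: "0 < \<mu>" and ev: "eigenvalue D (complex_of_real \<mu>)"
    and bound: "\<And>\<nu>. eigenvalue D \<nu> \<Longrightarrow> cmod \<nu> \<le> \<mu>"
  obtains v where "\<And>i. i < m \<Longrightarrow> 0 < v i" "\<And>i. i < m \<Longrightarrow> (\<Sum>j<m. d i j * v j) = \<mu> * v i"
proof -
  obtain z where z: "\<exists>i<m. z i \<noteq> 0"
      "\<And>i. i < m \<Longrightarrow> (\<Sum>j<m. D $$ (i, j) * z j) = complex_of_real \<mu> * z i"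
    using ev eigenvalue_coordinates[OF D] by blast
  define u where "u i = cmod (z i)" for i
  define y where "y i = (\<Sum>j<m. d i j * u j)" for i
  obtain i0 where i0: "i0 < m" "0 < u i0" using z(1) by (auto simp: u_def)
  have ypos: "0 < y i" if "i < m" for i
  proof -
    have "0 \<le> d i j * u j" if "j < m" for j
      using pos[OF \<open>i < m\<close> that] by (simp add: u_def)
    thus ?thesis
      unfolding y_def using i0 that pos by (intro sum_pos2[of _ i0]) auto
  qed
  have sub: "\<mu> * u i \<le> y i" if "i < m" for i
  proof -
    have "\<mu> * u i = cmod (\<Sum>j<m. D $$ (i, j) * z j)"
      using z(2)[OF that] mu by (simp add: norm_mult u_def)
    also have "\<dots> \<le> (\<Sum>j<m. cmod (D $$ (i, j) * z j))" by (rule norm_sum)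
    also have "\<dots> = y i"
      unfolding y_def using that pos
      by (intro sum.cong) (auto simp: norm_mult real u_def less_imp_le)
    finally show ?thesis .
  qed
  have eq: "y i = \<mu> * u i" if i: "i < m" for i
  proof (rule ccontr)
    assume "y i \<noteq> \<mu> * u i"
    hence lt: "\<mu> * u i < y i" using sub[OF i] by simp
    have strict: "\<mu> * y l < (\<Sum>j<m. d l j * y j)" if l: "l < m" for l
    proof -
      have "0 \<le> d l j * (y j - \<mu> * u j)" if "j < m" for j
        using pos[OF l that] sub[OF that] by simp
      hence "0 < (\<Sum>j<m. d l j * (y j - \<mu> * u j))"
        using i lt pos[OF l i] by (intro sum_pos2[of _ i]) auto
      also have "\<dots> = (\<Sum>j<m. d l j * y j) - \<mu> * y l"
        by (simp add: y_def right_diff_distrib sum_subtractf sum_distrib_left mult.left_commute)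
      finally show ?thesis by simp
    qed
    define \<rho> where "\<rho> = Min ((\<lambda>l. (\<Sum>j<m. d l j * y j) / y l) ` {..<m})"
    have "\<mu> < \<rho>"
      unfolding \<rho>_def using i strict ypos
      by (subst Min_gr_iff) (auto simp: field_simps)
    moreover have "\<rho> * y l \<le> (\<Sum>j<m. d l j * y j)" if l: "l < m" for l
    proof -
      have "\<rho> \<le> (\<Sum>j<m. d l j * y j) / y l"
        unfolding \<rho>_def using l by (intro Min_le) auto
      thus ?thesis using ypos[OF l] by (simp add: field_simps)
    qed
    ultimately show False
      using subinvariance_bound[OF D real, of \<mu> y \<rho>] pos bound mu i ypos
      by (auto simp: less_imp_le)
  qed
  show thesis
  proof
    show "0 < u i" if "i < m" for i using eq[OF that] ypos[OF that] mu by (simp add: zero_less_mult_iff)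
    show "(\<Sum>j<m. d i j * u j) = \<mu> * u i" if "i < m" for i using eq[OF that] by (simp add: y_def)
  qed
qed

text \<open>
  The weighted norm \<open>\<Sum> w\<^sub>i |x\<^sub>i|\<close> is contracted by \<open>D / \<mu>\<close> on the kernel of \<open>w\<close>. On this kernel
  \<open>D\<close> may be replaced by \<open>D - \<epsilon> v w\<^sup>T\<close>, which for small \<open>\<epsilon>\<close> still has nonnegative entries while its
  column sums with weights \<open>w\<close> drop from \<open>\<mu> w\<^sub>j\<close> to \<open>(\<mu> - \<epsilon>) w\<^sub>j\<close>.
\<close>

lemma positive_matrix_contraction:
  fixes d :: "nat \<Rightarrow> nat \<Rightarrow> real"
  assumes m: "0 < m" and pos: "\<And>i j. i < m \<Longrightarrow> j < m \<Longrightarrow> 0 < d i j" and mu: "0 < \<mu>"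
    and v: "\<And>i. i < m \<Longrightarrow> 0 < v i"
    and w: "\<And>i. i < m \<Longrightarrow> 0 < w i"
    and left: "\<And>j. j < m \<Longrightarrow> (\<Sum>i<m. w i * d i j) = \<mu> * w j"
    and norm: "(\<Sum>i<m. w i * v i) = 1"
  obtains q where "0 \<le> q" "q < 1"
    "\<And>x :: nat \<Rightarrow> complex. (\<Sum>i<m. of_real (w i) * x i) = 0 \<Longrightarrow>
      (\<Sum>i<m. w i * cmod ((\<Sum>j<m. of_real (d i j) * x j) / of_real \<mu>)) \<le> q * (\<Sum>i<m. w i * cmod (x i))"
proof -
  define \<epsilon> where "\<epsilon> = Min ((\<lambda>(i, j). d i j / (v i * w j)) ` ({..<m} \<times> {..<m}))"
  have e0: "0 < \<epsilon>"
    unfolding \<epsilon>_def using m pos v w by (subst Min_gr_iff) auto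
  have e: "\<epsilon> * (v i * w j) \<le> d i j" if "i < m" "j < m" for i j
  proof -
    have "\<epsilon> \<le> d i j / (v i * w j)"
      unfolding \<epsilon>_def using that by (intro Min_le) auto
    thus ?thesis using v[OF that(1)] w[OF that(2)] by (simp add: field_simps)
  qed
  have col: "(\<Sum>i<m. w i * (d i j - \<epsilon> * (v i * w j))) = (\<mu> - \<epsilon>) * w j" if "j < m" for j
  proof -
    have "(\<Sum>i<m. w i * (d i j - \<epsilon> * (v i * w j)))
        = (\<Sum>i<m. w i * d i j) - \<epsilon> * w j * (\<Sum>i<m. w i * v i)"
      by (simp add: right_diff_distrib sum_subtractf sum_distrib_left mult_ac)
    thus ?thesis using left[OF that] norm by (simp add: algebra_simps)
  qed
  have "0 \<le> (\<mu> - \<epsilon>) * w 0"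
    using col[OF m, symmetric] e m w by (auto intro!: sum_nonneg simp: less_imp_le)
  hence em: "\<epsilon> \<le> \<mu>" using w[OF m] by (simp add: zero_le_mult_iff)
  show thesis
  proof (rule that[of "(\<mu> - \<epsilon>) / \<mu>"])
    show "0 \<le> (\<mu> - \<epsilon>) / \<mu>" "(\<mu> - \<epsilon>) / \<mu> < 1" using em e0 mu by auto
    fix x :: "nat \<Rightarrow> complex"
    assume x: "(\<Sum>i<m. of_real (w i) * x i) = 0"
    have one: "cmod (\<Sum>j<m. of_real (d i j) * x j) \<le> (\<Sum>j<m. (d i j - \<epsilon> * (v i * w j)) * cmod (x j))"
      if i: "i < m" for i
    proof -
      have "(\<Sum>j<m. of_real (d i j - \<epsilon> * (v i * w j)) * x j)
          = (\<Sum>j<m. of_real (d i j) * x j) - of_real (\<epsilon> * v i) * (\<Sum>j<m. of_real (w j) * x j)"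
        by (simp add: left_diff_distrib sum_subtractf sum_distrib_left mult.assoc)
      hence "cmod (\<Sum>j<m. of_real (d i j) * x j) = cmod (\<Sum>j<m. of_real (d i j - \<epsilon> * (v i * w j)) * x j)"
        by (simp only: x) simp
      also have "\<dots> \<le> (\<Sum>j<m. cmod (of_real (d i j - \<epsilon> * (v i * w j)) * x j))" by (rule norm_sum)
      also have "\<dots> = (\<Sum>j<m. (d i j - \<epsilon> * (v i * w j)) * cmod (x j))"
        using e[OF i] by (intro sum.cong refl) (simp only: norm_mult norm_of_real, simp)
      finally show ?thesis .
    qed
    have "(\<Sum>i<m. w i * cmod ((\<Sum>j<m. of_real (d i j) * x j) / of_real \<mu>))
        = (\<Sum>i<m. w i * cmod (\<Sum>j<m. of_real (d i j) * x j)) / \<mu>"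
      unfolding norm_divide using mu by (simp add: sum_divide_distrib)
    also have "\<dots> \<le> (\<Sum>i<m. w i * (\<Sum>j<m. (d i j - \<epsilon> * (v i * w j)) * cmod (x j))) / \<mu>"
      using one w mu by (intro divide_right_mono sum_mono mult_left_mono) (auto intro: less_imp_le)
    also have "(\<Sum>i<m. w i * (\<Sum>j<m. (d i j - \<epsilon> * (v i * w j)) * cmod (x j)))
        = (\<Sum>i<m. \<Sum>j<m. w i * (d i j - \<epsilon> * (v i * w j)) * cmod (x j))"
      by (simp add: sum_distrib_left mult.assoc)
    also have "\<dots> = (\<Sum>j<m. \<Sum>i<m. w i * (d i j - \<epsilon> * (v i * w j)) * cmod (x j))" by (rule sum.swap)
    also have "\<dots> = (\<Sum>j<m. (\<mu> - \<epsilon>) * w j * cmod (x j))"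
      by (simp add: sum_distrib_right[symmetric] col)
    also have "\<dots> / \<mu> = (\<mu> - \<epsilon>) / \<mu> * (\<Sum>i<m. w i * cmod (x i))"
      by (simp add: sum_distrib_left[symmetric] mult.assoc)
    finally show "(\<Sum>i<m. w i * cmod ((\<Sum>j<m. of_real (d i j) * x j) / of_real \<mu>))
      \<le> (\<mu> - \<epsilon>) / \<mu> * (\<Sum>i<m. w i * cmod (x i))" .
  qed
qed

text \<open>
  The left eigenvector is the right eigenvector of the transpose, rescaled so that \<open>w \<cdot> v = 1\<close>.
\<close>

lemma perron_frobenius_vectors:
  fixes D :: "complex mat"
  assumes D: "D \<in> carrier_mat m m"
    and real: "\<And>i j. i < m \<Longrightarrow> j < m \<Longrightarrow> D $$ (i, j) = complex_of_real (d i j)"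
    and pos: "\<And>i j. i < m \<Longrightarrow> j < m \<Longrightarrow> 0 < d i j"
    and pf: "perron_frobenius_eigenvalue D \<mu>"
  obtains v w where "\<And>i. i < m \<Longrightarrow> 0 < v i" "\<And>i. i < m \<Longrightarrow> 0 < w i"
    "\<And>i. i < m \<Longrightarrow> (\<Sum>j<m. d i j * v j) = \<mu> * v i"
    "\<And>j. j < m \<Longrightarrow> (\<Sum>i<m. w i * d i j) = \<mu> * w j"
    "(\<Sum>i<m. w i * v i) = 1"
proof -
  have mu: "0 < \<mu>" and ev: "eigenvalue D (complex_of_real \<mu>)"
    using pf by (auto simp: perron_frobenius_eigenvalue_def)
  have bound: "cmod \<nu> \<le> \<mu>" if "eigenvalue D \<nu>" for \<nu>
  proof (cases "\<nu> = complex_of_real \<mu>")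
    case True thus ?thesis using mu by simp
  next
    case False
    hence "cmod \<nu> < \<mu>" using pf that by (auto simp: perron_frobenius_eigenvalue_def)
    thus ?thesis by simp
  qed
  obtain v where v: "\<And>i. i < m \<Longrightarrow> 0 < v i" "\<And>i. i < m \<Longrightarrow> (\<Sum>j<m. d i j * v j) = \<mu> * v i"
    using positive_eigenvector[OF D real pos mu ev bound] by blast
  have T: "transpose_mat D \<in> carrier_mat m m" using D by simp
  have realT: "transpose_mat D $$ (i, j) = complex_of_real (d j i)" if "i < m" "j < m" for i j
    using that D real by simp
  obtain w where w: "\<And>i. i < m \<Longrightarrow> 0 < w i" "\<And>j. j < m \<Longrightarrow> (\<Sum>i<m. d i j * w i) = \<mu> * w j"
    using positive_eigenvector[OF T realT pos mu] ev bound
    unfolding eigenvalue_transpose[OF D] by blast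
  have m: "0 < m" using ev eigenvalue_coordinates[OF D] by auto
  define s where "s = (\<Sum>i<m. w i * v i)"
  have s: "0 < s" unfolding s_def using v(1) w(1) m by (intro sum_pos) auto
  show thesis
  proof
    show "0 < v i" "(\<Sum>j<m. d i j * v j) = \<mu> * v i" if "i < m" for i using v that by auto
    show "0 < w i / s" if "i < m" for i using w s that by auto
    show "(\<Sum>i<m. w i / s * d i j) = \<mu> * (w j / s)" if "j < m" for j
      using w(2)[OF that] by (simp add: sum_divide_distrib[symmetric] mult.commute)
    show "(\<Sum>i<m. w i / s * v i) = 1"
      using s by (simp add: sum_divide_distrib[symmetric] s_def[symmetric])
  qed
qed

section \<open>Eigenfunctionals of a positive matrix on subspaces\<close>

text \<open>
  A functional on a subspace \<open>S\<close> of \<open>\<k>\<^sup>m\<close> with values in the complex numbers extends to \<open>\<k>\<^sup>m\<close>: this is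
  Gaussian elimination, by induction on the number \<open>j\<close> of coordinates that may be nonzero. The
  subspace enters through the map \<open>co\<close> from an arbitrary type, so that it can be a submodule of an
  abstract module; the hypothesis \<open>combine\<close> is linearity of \<open>co\<close> and \<open>\<phi>\<close> in the only form needed to
  eliminate an entry.
\<close>

lemma functional_in_coordinates:
  fixes co :: "'v \<Rightarrow> nat \<Rightarrow> complex" and \<phi> :: "'v \<Rightarrow> complex"
  assumes combine: "\<And>x y \<kappa>. x \<in> S \<Longrightarrow> y \<in> S \<Longrightarrow> \<kappa> \<in> \<k> \<Longrightarrow>
      \<exists>z\<in>S. (\<forall>i<m. co z i = co x i - \<kappa> * co y i) \<and> \<phi> z = \<phi> x - \<kappa> * \<phi> y"
    and coords: "\<And>x i. x \<in> S \<Longrightarrow> i < m \<Longrightarrow> co x i \<in> \<k>"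
    and division: "\<And>\<kappa> \<kappa>'. \<kappa> \<in> \<k> \<Longrightarrow> \<kappa>' \<in> \<k> \<Longrightarrow> \<kappa> / \<kappa>' \<in> \<k>"
    and injective: "\<And>x. x \<in> S \<Longrightarrow> (\<And>i. i < m \<Longrightarrow> co x i = 0) \<Longrightarrow> \<phi> x = 0"
  obtains f where "\<And>x. x \<in> S \<Longrightarrow> \<phi> x = (\<Sum>i<m. f i * co x i)"
proof -
  have "\<exists>f. \<forall>x\<in>S. (\<forall>i<m. j \<le> i \<longrightarrow> co x i = 0) \<longrightarrow> \<phi> x = (\<Sum>i<j. f i * co x i)" if "j \<le> m" for j
    using that
  proof (induction j)
    case 0
    thus ?case using injective by auto
  next
    case (Suc j)
    then obtain f where f: "\<And>x. x \<in> S \<Longrightarrow> (\<And>i. i < m \<Longrightarrow> j \<le> i \<Longrightarrow> co x i = 0) \<Longrightarrow>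
        \<phi> x = (\<Sum>i<j. f i * co x i)"
      by (metis Suc_leD)
    show ?case
    proof (cases "\<exists>y\<in>S. (\<forall>i<m. Suc j \<le> i \<longrightarrow> co y i = 0) \<and> co y j \<noteq> 0")
      case False
      show ?thesis
      proof (intro exI[of _ f] ballI impI)
        fix x assume x: "x \<in> S" "\<forall>i<m. Suc j \<le> i \<longrightarrow> co x i = 0"
        hence 0: "co x j = 0" using False by blast
        have "co x i = 0" if "i < m" "j \<le> i" for i
          using that 0 x(2) by (cases "i = j") auto
        thus "\<phi> x = (\<Sum>i<Suc j. f i * co x i)" using f[OF x(1)] 0 by simp
      qed
    next
      case True
      then obtain y where y: "y \<in> S" "\<And>i. i < m \<Longrightarrow> Suc j \<le> i \<Longrightarrow> co y i = 0" "co y j \<noteq> 0"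
        by blast
      \<comment> \<open>The value of the new coefficient is forced by the pivot vector \<open>y\<close>.\<close>
      define t where "t = (\<phi> y - (\<Sum>i<j. f i * co y i)) / co y j"
      show ?thesis
      proof (intro exI[of _ "f(j := t)"] ballI impI)
        fix x assume x: "x \<in> S" "\<forall>i<m. Suc j \<le> i \<longrightarrow> co x i = 0"
        define \<kappa> where "\<kappa> = co x j / co y j"
        have "\<kappa> \<in> \<k>" unfolding \<kappa>_def using Suc.prems by (intro division coords x y) auto
        then obtain z where z: "z \<in> S" "\<And>i. i < m \<Longrightarrow> co z i = co x i - \<kappa> * co y i"
            "\<phi> z = \<phi> x - \<kappa> * \<phi> y"
          using combine[OF x(1) y(1)] by blast
        have "co z i = 0" if "i < m" "j \<le> i" for i
        proof (cases "i = j")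
          case True thus ?thesis using z(2)[OF that(1)] y(3) by (simp add: \<kappa>_def)
        next
          case False
          hence "Suc j \<le> i" using that(2) by simp
          thus ?thesis using z(2)[OF that(1)] x(2) y(2) that(1) by simp
        qed
        hence "\<phi> z = (\<Sum>i<j. f i * co z i)" using f[OF z(1)] by blast
        also have "\<dots> = (\<Sum>i<j. f i * co x i - \<kappa> * (f i * co y i))"
          using Suc.prems by (intro sum.cong refl) (simp add: z(2) right_diff_distrib mult.left_commute)
        also have "\<dots> = (\<Sum>i<j. f i * co x i) - \<kappa> * (\<Sum>i<j. f i * co y i)"
          by (simp add: sum_subtractf sum_distrib_left)
        finally have "\<phi> x = (\<Sum>i<j. f i * co x i) + \<kappa> * (\<phi> y - (\<Sum>i<j. f i * co y i))"
          using z(3) by (simp add: algebra_simps)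
        also have "\<kappa> * (\<phi> y - (\<Sum>i<j. f i * co y i)) = t * co x j"
          using y(3) by (simp add: t_def \<kappa>_def)
        also have "(\<Sum>i<j. f i * co x i) = (\<Sum>i<j. (f(j := t)) i * co x i)"
          by (intro sum.cong) auto
        finally show "\<phi> x = (\<Sum>i<Suc j. (f(j := t)) i * co x i)" by simp
      qed
    qed
  qed
  from this[of m] that show thesis by fastforce
qed

text \<open>
  Write the coordinates of \<open>x\<close> as \<open>W x \<cdot> v + z\<close> with \<open>w \<cdot> z = 0\<close>. Applying \<open>T\<^sup>k\<close> and dividing by
  \<open>\<mu>\<^sup>k\<close> fixes the first summand and contracts the second one to zero, while \<open>\<phi>\<close> is unchanged by the
  eigenvalue equation. So \<open>\<phi> x = f \<cdot> (W x \<cdot> v)\<close>, although \<open>f\<close> is an eigenvector only as seen from \<open>S\<close>.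
\<close>

lemma eigenfunctional_multiple:
  fixes co :: "'v \<Rightarrow> nat \<Rightarrow> complex" and \<phi> :: "'v \<Rightarrow> complex" and d :: "nat \<Rightarrow> nat \<Rightarrow> real"
  assumes pos: "\<And>i j. i < m \<Longrightarrow> j < m \<Longrightarrow> 0 < d i j" and mu: "0 < \<mu>"
    and v: "\<And>i. i < m \<Longrightarrow> 0 < v i" and w: "\<And>i. i < m \<Longrightarrow> 0 < w i"
    and right: "\<And>i. i < m \<Longrightarrow> (\<Sum>j<m. d i j * v j) = \<mu> * v i"
    and left: "\<And>j. j < m \<Longrightarrow> (\<Sum>i<m. w i * d i j) = \<mu> * w j"
    and norm: "(\<Sum>i<m. w i * v i) = 1"
    and closed: "\<And>x. x \<in> S \<Longrightarrow> T x \<in> S"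
    and matrix: "\<And>x i. x \<in> S \<Longrightarrow> i < m \<Longrightarrow> co (T x) i = (\<Sum>j<m. of_real (d i j) * co x j)"
    and f: "\<And>x. x \<in> S \<Longrightarrow> \<phi> x = (\<Sum>i<m. f i * co x i)"
    and eigen: "\<And>x. x \<in> S \<Longrightarrow> \<phi> (T x) = of_real \<mu> * \<phi> x"
    and x: "x \<in> S"
  shows "\<phi> x = (\<Sum>i<m. f i * of_real (v i)) * (\<Sum>i<m. of_real (w i) * co x i)"
proof -
  have m: "0 < m" using norm by (cases m) auto
  define W where "W y = (\<Sum>i<m. of_real (w i) * co y i)" for y
  define N where "N z = (\<Sum>i<m. w i * cmod (z i))" for z
  define X where "X k = (T ^^ k) x" for k
  define Z where "Z k i = co (X k) i / of_real \<mu> ^ k - W x * of_real (v i)" for k i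
  have X: "X k \<in> S" for k by (induction k) (auto simp: X_def x closed)
  have XS: "X (Suc k) = T (X k)" for k by (simp add: X_def)
  have leftC: "(\<Sum>i<m. of_real (w i) * complex_of_real (d i j)) = of_real \<mu> * of_real (w j)"
    if "j < m" for j
    using arg_cong[OF left[OF that], of complex_of_real] by simp
  have WT: "W (T y) = of_real \<mu> * W y" if "y \<in> S" for y
  proof -
    have "W (T y) = (\<Sum>i<m. \<Sum>j<m. of_real (w i) * (of_real (d i j) * co y j))"
      using that by (simp add: W_def matrix sum_distrib_left)
    also have "\<dots> = (\<Sum>j<m. (\<Sum>i<m. of_real (w i) * of_real (d i j)) * co y j)"
      by (subst sum.swap) (simp add: sum_distrib_right mult.assoc)
    also have "\<dots> = (\<Sum>j<m. of_real \<mu> * of_real (w j) * co y j)"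
      by (intro sum.cong refl) (simp only: leftC lessThan_iff)
    also have "\<dots> = of_real \<mu> * W y"
      by (simp add: W_def sum_distrib_left mult.assoc)
    finally show ?thesis .
  qed
  have WX: "W (X k) = of_real \<mu> ^ k * W x" for k
  proof (induction k)
    case 0 show ?case by (simp add: X_def)
  next
    case (Suc k) thus ?case using WT[OF X] by (simp add: XS)
  qed
  have phiX: "\<phi> (X k) = of_real \<mu> ^ k * \<phi> x" for k
  proof (induction k)
    case 0 show ?case by (simp add: X_def)
  next
    case (Suc k) thus ?case using eigen[OF X] by (simp add: XS)
  qed
  have normC: "(\<Sum>i<m. of_real (w i) * complex_of_real (v i)) = 1"
    using arg_cong[OF norm, of complex_of_real] by simp
  have WZ: "(\<Sum>i<m. of_real (w i) * Z k i) = 0" for k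
  proof -
    have "(\<Sum>i<m. of_real (w i) * Z k i)
        = W (X k) / of_real \<mu> ^ k - W x * (\<Sum>i<m. of_real (w i) * of_real (v i))"
      by (simp add: Z_def W_def right_diff_distrib sum_subtractf sum_divide_distrib sum_distrib_left
          mult.left_commute)
    thus ?thesis using mu by (simp add: WX normC)
  qed
  have rightC: "(\<Sum>j<m. of_real (d i j) * complex_of_real (v j)) = of_real \<mu> * of_real (v i)"
    if "i < m" for i
    using arg_cong[OF right[OF that], of complex_of_real] by simp
  have ZS: "Z (Suc k) i = (\<Sum>j<m. of_real (d i j) * Z k j) / of_real \<mu>" if i: "i < m" for i k
  proof -
    have "(\<Sum>j<m. of_real (d i j) * Z k j)
        = co (X (Suc k)) i / of_real \<mu> ^ k - W x * (\<Sum>j<m. of_real (d i j) * of_real (v j))"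
      by (simp add: Z_def XS matrix[OF X i] right_diff_distrib sum_subtractf sum_divide_distrib
          sum_distrib_left mult.left_commute)
    thus ?thesis using mu by (simp add: rightC[OF i] Z_def diff_divide_distrib)
  qed
  obtain q where q: "0 \<le> q" "q < 1" "\<And>x :: nat \<Rightarrow> complex. (\<Sum>i<m. of_real (w i) * x i) = 0 \<Longrightarrow>
      (\<Sum>i<m. w i * cmod ((\<Sum>j<m. of_real (d i j) * x j) / of_real \<mu>)) \<le> q * (\<Sum>i<m. w i * cmod (x i))"
    using positive_matrix_contraction[OF m pos mu v w left norm] by blast
  have NS: "N (Z (Suc k)) \<le> q * N (Z k)" for k
  proof -
    have "N (Z (Suc k)) = (\<Sum>i<m. w i * cmod ((\<Sum>j<m. of_real (d i j) * Z k j) / of_real \<mu>))"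
      unfolding N_def by (intro sum.cong refl) (simp only: ZS lessThan_iff)
    thus ?thesis using q(3)[OF WZ[of k]] by (simp only: N_def)
  qed
  have NZ: "N (Z k) \<le> q ^ k * N (Z 0)" for k
  proof (induction k)
    case 0 show ?case by simp
  next
    case (Suc k)
    have "N (Z (Suc k)) \<le> q * (q ^ k * N (Z 0))"
      using NS[of k] mult_left_mono[OF Suc q(1)] by linarith
    thus ?case by (simp add: mult.assoc)
  qed
  define K where "K = (\<Sum>i<m. cmod (f i) / w i)"
  define \<delta> where "\<delta> = \<phi> x - (\<Sum>i<m. f i * of_real (v i)) * W x"
  have phi_eq: "\<delta> = (\<Sum>i<m. f i * Z k i)" for k
  proof -
    have "(\<Sum>i<m. f i * Z k i) = \<phi> (X k) / of_real \<mu> ^ k - (\<Sum>i<m. f i * of_real (v i)) * W x"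
      by (simp add: f[OF X] Z_def right_diff_distrib sum_subtractf sum_divide_distrib
          sum_distrib_left mult_ac)
    thus ?thesis using mu by (simp add: phiX \<delta>_def)
  qed
  have wN: "w i * cmod (z i) \<le> N z" if "i < m" for i z
    unfolding N_def using that w
    by (intro member_le_sum) (auto intro!: mult_nonneg_nonneg simp: less_imp_le)
  have small: "cmod \<delta> \<le> q ^ k * (K * N (Z 0))" for k
  proof -
    have "cmod \<delta> \<le> (\<Sum>i<m. cmod (f i) * cmod (Z k i))"
      unfolding phi_eq[of k] by (rule order.trans[OF norm_sum]) (simp add: norm_mult)
    also have "\<dots> \<le> (\<Sum>i<m. cmod (f i) / w i * N (Z k))"
    proof (intro sum_mono)
      fix i assume "i \<in> {..<m}"
      hence i: "i < m" by simp
      have "cmod (f i) * cmod (Z k i) = cmod (f i) / w i * (w i * cmod (Z k i))"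
        using w[OF i] by simp
      also have "\<dots> \<le> cmod (f i) / w i * N (Z k)"
        using wN[OF i] w[OF i] by (intro mult_left_mono) auto
      finally show "cmod (f i) * cmod (Z k i) \<le> cmod (f i) / w i * N (Z k)" .
    qed
    also have "\<dots> = K * N (Z k)" by (simp add: K_def sum_distrib_right)
    also have "\<dots> \<le> K * (q ^ k * N (Z 0))"
      unfolding K_def using NZ w by (intro mult_left_mono sum_nonneg) (auto simp: less_imp_le)
    finally show ?thesis by (simp add: mult_ac)
  qed
  have "(\<lambda>k. q ^ k * (K * N (Z 0))) \<longlonglongrightarrow> 0 * (K * N (Z 0))"
    using q by (intro tendsto_mult tendsto_const LIMSEQ_realpow_zero)
  hence "cmod \<delta> \<le> 0"
    using small by (intro LIMSEQ_le_const) auto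
  thus ?thesis by (simp add: \<delta>_def W_def)
qed

section \<open>Left modules and their subquotients\<close>

locale left_module = ring R + M: abelian_group M
  for R :: "('a, 'b) ring_scheme" and M :: "('a, 'm) module" +
  assumes smult_closed: "\<lbrakk>r \<in> carrier R; x \<in> carrier M\<rbrakk> \<Longrightarrow> r \<odot>\<^bsub>M\<^esub> x \<in> carrier M"
    and smult_l_distr: "\<lbrakk>r \<in> carrier R; s \<in> carrier R; x \<in> carrier M\<rbrakk>
      \<Longrightarrow> (r \<oplus>\<^bsub>R\<^esub> s) \<odot>\<^bsub>M\<^esub> x = r \<odot>\<^bsub>M\<^esub> x \<oplus>\<^bsub>M\<^esub> s \<odot>\<^bsub>M\<^esub> x"
    and smult_r_distr: "\<lbrakk>r \<in> carrier R; x \<in> carrier M; y \<in> carrier M\<rbrakk>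
      \<Longrightarrow> r \<odot>\<^bsub>M\<^esub> (x \<oplus>\<^bsub>M\<^esub> y) = r \<odot>\<^bsub>M\<^esub> x \<oplus>\<^bsub>M\<^esub> r \<odot>\<^bsub>M\<^esub> y"
    and smult_assoc: "\<lbrakk>r \<in> carrier R; s \<in> carrier R; x \<in> carrier M\<rbrakk>
      \<Longrightarrow> (r \<otimes>\<^bsub>R\<^esub> s) \<odot>\<^bsub>M\<^esub> x = r \<odot>\<^bsub>M\<^esub> (s \<odot>\<^bsub>M\<^esub> x)"
    and smult_one: "x \<in> carrier M \<Longrightarrow> \<one>\<^bsub>R\<^esub> \<odot>\<^bsub>M\<^esub> x = x"
begin

lemma smult_zero:
  assumes "x \<in> carrier M"
  shows "\<zero>\<^bsub>R\<^esub> \<odot>\<^bsub>M\<^esub> x = \<zero>\<^bsub>M\<^esub>"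
proof -
  have "\<zero>\<^bsub>R\<^esub> \<odot>\<^bsub>M\<^esub> x \<oplus>\<^bsub>M\<^esub> \<zero>\<^bsub>R\<^esub> \<odot>\<^bsub>M\<^esub> x = \<zero>\<^bsub>R\<^esub> \<odot>\<^bsub>M\<^esub> x"
    using smult_l_distr[of "\<zero>\<^bsub>R\<^esub>" "\<zero>\<^bsub>R\<^esub>" x] assms by simp
  thus ?thesis using smult_closed[of "\<zero>\<^bsub>R\<^esub>" x] assms
    by (metis M.add.l_cancel_one' zero_closed)
qed

lemma smult_minus_one:
  assumes "x \<in> carrier M"
  shows "(\<ominus>\<^bsub>R\<^esub> \<one>\<^bsub>R\<^esub>) \<odot>\<^bsub>M\<^esub> x = \<ominus>\<^bsub>M\<^esub> x"
proof -
  have "(\<ominus>\<^bsub>R\<^esub> \<one>\<^bsub>R\<^esub>) \<odot>\<^bsub>M\<^esub> x \<oplus>\<^bsub>M\<^esub> x = \<zero>\<^bsub>M\<^esub>"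
    using smult_l_distr[of "\<ominus>\<^bsub>R\<^esub> \<one>\<^bsub>R\<^esub>" "\<one>\<^bsub>R\<^esub>" x] assms
    by (simp add: smult_one smult_zero l_neg)
  thus ?thesis using assms smult_closed[of "\<ominus>\<^bsub>R\<^esub> \<one>\<^bsub>R\<^esub>" x] M.minus_equality by simp
qed

lemma submoduleI:
  assumes "H \<subseteq> carrier M" "\<zero>\<^bsub>M\<^esub> \<in> H"
    and "\<And>x y. \<lbrakk>x \<in> H; y \<in> H\<rbrakk> \<Longrightarrow> x \<oplus>\<^bsub>M\<^esub> y \<in> H"
    and smult: "\<And>r x. \<lbrakk>r \<in> carrier R; x \<in> H\<rbrakk> \<Longrightarrow> r \<odot>\<^bsub>M\<^esub> x \<in> H"
  shows "Module.submodule H R M"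
proof -
  have "\<ominus>\<^bsub>M\<^esub> x \<in> H" if "x \<in> H" for x
  proof -
    have "x \<in> carrier M" using that assms(1) by blast
    from smult_minus_one[OF this] show ?thesis
      using smult[of "\<ominus>\<^bsub>R\<^esub> \<one>\<^bsub>R\<^esub>" x] that by simp
  qed
  thus ?thesis
    using assms unfolding Module.submodule_def Module.submodule_axioms_def subgroup_def a_inv_def
    by simp
qed

lemma submoduleD:
  assumes "Module.submodule H R M"
  shows "H \<subseteq> carrier M" "\<zero>\<^bsub>M\<^esub> \<in> H"
    and "\<And>x y. \<lbrakk>x \<in> H; y \<in> H\<rbrakk> \<Longrightarrow> x \<oplus>\<^bsub>M\<^esub> y \<in> H"
    and "\<And>r x. \<lbrakk>r \<in> carrier R; x \<in> H\<rbrakk> \<Longrightarrow> r \<odot>\<^bsub>M\<^esub> x \<in> H"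
    and "\<And>x. x \<in> H \<Longrightarrow> \<ominus>\<^bsub>M\<^esub> x \<in> H"
    and "\<And>x y. \<lbrakk>x \<in> H; y \<in> H\<rbrakk> \<Longrightarrow> x \<ominus>\<^bsub>M\<^esub> y \<in> H"
proof -
  interpret sub: Module.submodule H R M by fact
  show sub: "H \<subseteq> carrier M" and "\<zero>\<^bsub>M\<^esub> \<in> H"
    and add: "\<And>x y. \<lbrakk>x \<in> H; y \<in> H\<rbrakk> \<Longrightarrow> x \<oplus>\<^bsub>M\<^esub> y \<in> H"
    and "\<And>r x. \<lbrakk>r \<in> carrier R; x \<in> H\<rbrakk> \<Longrightarrow> r \<odot>\<^bsub>M\<^esub> x \<in> H"
    using sub.subset sub.one_closed sub.m_closed sub.smult_closed by auto
  show inv: "\<ominus>\<^bsub>M\<^esub> x \<in> H" if "x \<in> H" for x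
    using sub.m_inv_closed that by (simp add: a_inv_def)
  show "x \<ominus>\<^bsub>M\<^esub> y \<in> H" if "x \<in> H" "y \<in> H" for x y
    unfolding a_minus_def using that by (intro add inv)
qed

lemma submodule_abelian_subgroup:
  assumes "Module.submodule H R M"
  shows "abelian_subgroup H M"
  using assms M.a_comm_group unfolding Module.submodule_def by (intro abelian_subgroupI2) auto

lemma coset_eq_iff:
  assumes "Module.submodule H R M" "x \<in> carrier M" "y \<in> carrier M"
  shows "H +>\<^bsub>M\<^esub> x = H +>\<^bsub>M\<^esub> y \<longleftrightarrow> x \<ominus>\<^bsub>M\<^esub> y \<in> H"
proof -
  interpret H: abelian_subgroup H M by (rule submodule_abelian_subgroup) fact
  show ?thesis
    using assms H.a_rcos_module[of y x] H.a_repr_independence'[of x y] H.a_repr_independenceD[of x y]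
    unfolding a_minus_def by metis
qed

lemma restriction_left_module:
  assumes "Module.submodule H R M"
  shows "left_module R (M\<lparr>carrier := H\<rparr>)"
proof -
  note H = submoduleD[OF assms]
  have "abelian_group (M\<lparr>carrier := H\<rparr>)"
  proof (rule abelian_groupI, goal_cases)
    case (6 x)
    thus ?case using H(1,5) by (intro bexI[of _ "\<ominus>\<^bsub>M\<^esub> x"]) (auto simp: M.l_neg subset_iff)
  qed (use H in \<open>auto simp: M.a_ac subset_iff\<close>)
  moreover have "left_module_axioms R (M\<lparr>carrier := H\<rparr>)"
    by unfold_locales (use H in \<open>auto simp: smult_l_distr smult_r_distr smult_assoc smult_one subset_iff\<close>)
  ultimately show ?thesis
    using ring_axioms by (simp add: left_module_def)
qed

text \<open>
  This union is the scalar action of a quotient module; it collapses to the coset of a single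
  representative.
\<close>

lemma coset_smult:
  assumes H: "Module.submodule H R M" and r: "r \<in> carrier R" and x: "x \<in> carrier M"
  shows "(\<Union>y\<in>H +>\<^bsub>M\<^esub> x. H +>\<^bsub>M\<^esub> (r \<odot>\<^bsub>M\<^esub> y)) = H +>\<^bsub>M\<^esub> (r \<odot>\<^bsub>M\<^esub> x)"
proof -
  interpret H: abelian_subgroup H M by (rule submodule_abelian_subgroup) fact
  have "H +>\<^bsub>M\<^esub> (r \<odot>\<^bsub>M\<^esub> y) = H +>\<^bsub>M\<^esub> (r \<odot>\<^bsub>M\<^esub> x)" if y: "y \<in> H +>\<^bsub>M\<^esub> x" for y
  proof -
    obtain h where h: "h \<in> H" "y = h \<oplus>\<^bsub>M\<^esub> x"
      using y by (auto simp: a_r_coset_def r_coset_def)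
    have hc: "h \<in> carrier M" using h(1) submoduleD(1)[OF H] by blast
    have "r \<odot>\<^bsub>M\<^esub> y = r \<odot>\<^bsub>M\<^esub> h \<oplus>\<^bsub>M\<^esub> r \<odot>\<^bsub>M\<^esub> x"
      using h r x hc by (simp add: smult_r_distr)
    moreover have "r \<odot>\<^bsub>M\<^esub> h \<in> H" using submoduleD(4)[OF H r h(1)] .
    ultimately have "r \<odot>\<^bsub>M\<^esub> y \<in> H +>\<^bsub>M\<^esub> (r \<odot>\<^bsub>M\<^esub> x)"
      by (auto simp: a_r_coset_def r_coset_def)
    thus ?thesis using H.a_repr_independence' r x smult_closed by metis
  qed
  moreover have "x \<in> H +>\<^bsub>M\<^esub> x" by (rule H.a_rcos_self[OF x])
  ultimately show ?thesis by blast
qed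

lemma quotient_module_simps:
  assumes H: "Module.submodule H R M"
  shows "carrier (quotient_module M H) = (\<lambda>x. H +>\<^bsub>M\<^esub> x) ` carrier M"
    and "\<zero>\<^bsub>quotient_module M H\<^esub> = H"
    and "\<lbrakk>x \<in> carrier M; y \<in> carrier M\<rbrakk> \<Longrightarrow>
      (H +>\<^bsub>M\<^esub> x) \<oplus>\<^bsub>quotient_module M H\<^esub> (H +>\<^bsub>M\<^esub> y) = H +>\<^bsub>M\<^esub> (x \<oplus>\<^bsub>M\<^esub> y)"
    and "\<lbrakk>r \<in> carrier R; x \<in> carrier M\<rbrakk> \<Longrightarrow>
      r \<odot>\<^bsub>quotient_module M H\<^esub> (H +>\<^bsub>M\<^esub> x) = H +>\<^bsub>M\<^esub> (r \<odot>\<^bsub>M\<^esub> x)"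
proof -
  interpret H: abelian_subgroup H M by (rule submodule_abelian_subgroup) fact
  show "carrier (quotient_module M H) = (\<lambda>x. H +>\<^bsub>M\<^esub> x) ` carrier M"
    by (auto simp: quotient_module_def A_RCOSETS_def RCOSETS_def a_r_coset_def)
  show "\<zero>\<^bsub>quotient_module M H\<^esub> = H" by (simp add: quotient_module_def)
  show "\<lbrakk>x \<in> carrier M; y \<in> carrier M\<rbrakk> \<Longrightarrow>
      (H +>\<^bsub>M\<^esub> x) \<oplus>\<^bsub>quotient_module M H\<^esub> (H +>\<^bsub>M\<^esub> y) = H +>\<^bsub>M\<^esub> (x \<oplus>\<^bsub>M\<^esub> y)"
    by (simp add: quotient_module_def H.a_rcos_sum)
  show "\<lbrakk>r \<in> carrier R; x \<in> carrier M\<rbrakk> \<Longrightarrow>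
      r \<odot>\<^bsub>quotient_module M H\<^esub> (H +>\<^bsub>M\<^esub> x) = H +>\<^bsub>M\<^esub> (r \<odot>\<^bsub>M\<^esub> x)"
    using coset_smult[OF H] by (simp add: quotient_module_def)
qed

lemma quotient_left_module:
  assumes H: "Module.submodule H R M"
  shows "left_module R (quotient_module M H)"
proof -
  interpret H: abelian_subgroup H M by (rule submodule_abelian_subgroup) fact
  note simps = quotient_module_simps[OF H]
  have "abelian_group (quotient_module M H)"
  proof (rule abelian_groupI, goal_cases)
    case (6 X)
    then obtain x where x: "x \<in> carrier M" "X = H +>\<^bsub>M\<^esub> x" by (auto simp: simps)
    have "(H +>\<^bsub>M\<^esub> (\<ominus>\<^bsub>M\<^esub> x)) \<oplus>\<^bsub>quotient_module M H\<^esub> X = \<zero>\<^bsub>quotient_module M H\<^esub>"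
      using x H.a_rcos_const[OF submoduleD(2)[OF H]] by (simp add: simps M.l_neg)
    thus ?case using x by (auto simp: simps(1))
  next
    case 2
    show ?case using H.a_subgroup_in_rcosets by (simp add: quotient_module_def)
  next
    case (5 X)
    then obtain x where x: "x \<in> carrier M" "X = H +>\<^bsub>M\<^esub> x" by (auto simp: simps)
    have "\<zero>\<^bsub>quotient_module M H\<^esub> = H +>\<^bsub>M\<^esub> \<zero>\<^bsub>M\<^esub>"
      using H.a_rcos_const[OF submoduleD(2)[OF H]] by (simp add: simps)
    thus ?case using x by (simp add: simps(3))
  qed (auto simp: simps(1,3) M.a_ac)
  moreover have "left_module_axioms R (quotient_module M H)"
    by unfold_locales
      (auto simp: simps smult_closed smult_l_distr smult_r_distr smult_assoc smult_one)
  ultimately show ?thesis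
    using ring_axioms by (simp add: left_module_def)
qed

lemma coset_restrict: "Q +>\<^bsub>M\<lparr>carrier := P\<rparr>\<^esub> x = Q +>\<^bsub>M\<^esub> x"
  by (simp add: a_r_coset_def r_coset_def)

lemma subquotient_simps:
  assumes P: "Module.submodule P R M" and Q: "Module.submodule Q R M" and QP: "Q \<subseteq> P"
    and X: "X = quotient_module (M\<lparr>carrier := P\<rparr>) Q"
  shows "left_module R X"
    and "carrier X = (\<lambda>x. Q +>\<^bsub>M\<^esub> x) ` P"
    and "\<zero>\<^bsub>X\<^esub> = Q"
    and "\<And>x y. \<lbrakk>x \<in> P; y \<in> P\<rbrakk> \<Longrightarrow> (Q +>\<^bsub>M\<^esub> x) \<oplus>\<^bsub>X\<^esub> (Q +>\<^bsub>M\<^esub> y) = Q +>\<^bsub>M\<^esub> (x \<oplus>\<^bsub>M\<^esub> y)"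
    and "\<And>r x. \<lbrakk>r \<in> carrier R; x \<in> P\<rbrakk> \<Longrightarrow> r \<odot>\<^bsub>X\<^esub> (Q +>\<^bsub>M\<^esub> x) = Q +>\<^bsub>M\<^esub> (r \<odot>\<^bsub>M\<^esub> x)"
proof -
  interpret P: left_module R "M\<lparr>carrier := P\<rparr>" by (rule restriction_left_module[OF P])
  have Q': "Module.submodule Q R (M\<lparr>carrier := P\<rparr>)"
    using QP submoduleD[OF Q] by (intro P.submoduleI) auto
  note * = P.quotient_module_simps[OF Q', unfolded coset_restrict, simplified, folded X]
  show "left_module R X" unfolding X by (rule P.quotient_left_module[OF Q'])
  show "carrier X = (\<lambda>x. Q +>\<^bsub>M\<^esub> x) ` P" "\<zero>\<^bsub>X\<^esub> = Q"
    and "\<And>x y. \<lbrakk>x \<in> P; y \<in> P\<rbrakk> \<Longrightarrow> (Q +>\<^bsub>M\<^esub> x) \<oplus>\<^bsub>X\<^esub> (Q +>\<^bsub>M\<^esub> y) = Q +>\<^bsub>M\<^esub> (x \<oplus>\<^bsub>M\<^esub> y)"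
    and "\<And>r x. \<lbrakk>r \<in> carrier R; x \<in> P\<rbrakk> \<Longrightarrow> r \<odot>\<^bsub>X\<^esub> (Q +>\<^bsub>M\<^esub> x) = Q +>\<^bsub>M\<^esub> (r \<odot>\<^bsub>M\<^esub> x)"
    using * by auto
qed

text \<open>
  The image of \<open>H\<close> in the simple quotient \<open>P / Q\<close> is nonzero, hence everything: \<open>P = H + Q\<close>.
\<close>

lemma simple_subquotient_sum:
  assumes P: "Module.submodule P R M" and Q: "Module.submodule Q R M" and QP: "Q \<subseteq> P"
    and X: "X = quotient_module (M\<lparr>carrier := P\<rparr>) Q"
    and simple: "\<forall>H. Module.submodule H R X \<longrightarrow> H = {\<zero>\<^bsub>X\<^esub>} \<or> H = carrier X"
    and H: "Module.submodule H R M" and HP: "H \<subseteq> P" and HQ: "\<not> H \<subseteq> Q" and x: "x \<in> P"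
  obtains h where "h \<in> H" "x \<ominus>\<^bsub>M\<^esub> h \<in> Q"
proof -
  note sq = subquotient_simps[OF P Q QP X]
  interpret X: left_module R X by (rule sq(1))
  interpret Q: abelian_subgroup Q M by (rule submodule_abelian_subgroup[OF Q])
  note PM = submoduleD(1)[OF P] and HM = submoduleD[OF H]
  let ?I = "(\<lambda>x. Q +>\<^bsub>M\<^esub> x) ` H"
  have "Module.submodule ?I R X"
  proof (rule X.submoduleI)
    show "?I \<subseteq> carrier X" using HP by (auto simp: sq(2))
    show "\<zero>\<^bsub>X\<^esub> \<in> ?I"
      using HM(2) submoduleD(2)[OF Q] Q.a_rcos_const by (auto simp: sq(3) intro!: image_eqI)
    show "y \<oplus>\<^bsub>X\<^esub> z \<in> ?I" if "y \<in> ?I" "z \<in> ?I" for y z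
      using that HP HM(3) by (auto simp: sq(4) subset_iff)
    show "r \<odot>\<^bsub>X\<^esub> y \<in> ?I" if "r \<in> carrier R" "y \<in> ?I" for r y
      using that HP HM(4) by (auto simp: sq(5) subset_iff)
  qed
  moreover have "?I \<noteq> {\<zero>\<^bsub>X\<^esub>}"
  proof
    assume eq: "?I = {\<zero>\<^bsub>X\<^esub>}"
    have "h \<in> Q" if "h \<in> H" for h
      using eq that Q.a_rcos_self[of h] HM(1) unfolding sq(3) by blast
    thus False using HQ by blast
  qed
  ultimately have "?I = carrier X" using simple by blast
  then obtain h where h: "h \<in> H" "Q +>\<^bsub>M\<^esub> x = Q +>\<^bsub>M\<^esub> h"
    using x by (auto simp: sq(2) image_def set_eq_iff) blast
  thus thesis using that coset_eq_iff[OF Q, of x h] x PM HM(1) by blast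
qed

end

lemma regular_left_module:
  assumes "ring A"
  shows "left_module A (regular_module A)"
proof -
  interpret ring A by fact
  have "abelian_group (regular_module A)"
  proof (rule abelian_groupI, goal_cases)
    case (6 x)
    thus ?case
      by (intro bexI[of _ "\<ominus>\<^bsub>A\<^esub> x"]) (auto simp: regular_module_def l_neg)
  qed (auto simp: regular_module_def a_ac)
  moreover have "left_module_axioms A (regular_module A)"
    by unfold_locales (auto simp: regular_module_def l_distr r_distr m_assoc)
  ultimately show ?thesis
    using ring_axioms by (simp add: left_module_def)
qed

section \<open>Linear functionals and coordinates over a subfield of the complex numbers\<close>

text \<open>
  Values are complex while linearity is over \<open>\<k>\<close> only: a nonzero eigenfunctional whose eigenvalue lies
  outside \<open>\<k>\<close> cannot take all its values in \<open>\<k>\<close>.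
\<close>

definition linear_on :: "complex set \<Rightarrow> (complex, 'v) module \<Rightarrow> 'v set \<Rightarrow> ('v \<Rightarrow> complex) \<Rightarrow> bool" where
  "linear_on \<k> V S \<phi> \<longleftrightarrow>
     (\<forall>x\<in>S. \<forall>y\<in>S. \<phi> (x \<oplus>\<^bsub>V\<^esub> y) = \<phi> x + \<phi> y) \<and> (\<forall>\<kappa>\<in>\<k>. \<forall>x\<in>S. \<phi> (\<kappa> \<odot>\<^bsub>V\<^esub> x) = \<kappa> * \<phi> x)"

lemma linear_on_add: "\<lbrakk>linear_on \<k> V S \<phi>; x \<in> S; y \<in> S\<rbrakk> \<Longrightarrow> \<phi> (x \<oplus>\<^bsub>V\<^esub> y) = \<phi> x + \<phi> y"
  and linear_on_smult: "\<lbrakk>linear_on \<k> V S \<phi>; \<kappa> \<in> \<k>; x \<in> S\<rbrakk> \<Longrightarrow> \<phi> (\<kappa> \<odot>\<^bsub>V\<^esub> x) = \<kappa> * \<phi> x"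
  by (auto simp: linear_on_def)

lemma linear_on_subset: "\<lbrakk>linear_on \<k> V S \<phi>; S' \<subseteq> S\<rbrakk> \<Longrightarrow> linear_on \<k> V S' \<phi>"
  unfolding linear_on_def by blast

lemma linear_on_combination:
  assumes "\<And>i. i \<in> I \<Longrightarrow> linear_on \<k> V S (\<phi> i)"
  shows "linear_on \<k> V S (\<lambda>x. \<Sum>i\<in>I. c i * \<phi> i x)"
  using assms by (auto simp: linear_on_def distrib_left sum.distrib sum_distrib_left mult.left_commute
      cong: sum.cong intro!: sum.cong)

lemma linear_on_finsum:
  assumes V: "abelian_monoid V" and lin: "linear_on \<k> V S \<phi>"
    and S: "S \<subseteq> carrier V" "\<zero>\<^bsub>V\<^esub> \<in> S" "\<And>x y. \<lbrakk>x \<in> S; y \<in> S\<rbrakk> \<Longrightarrow> x \<oplus>\<^bsub>V\<^esub> y \<in> S"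
    and I: "finite I" and t: "\<And>i. i \<in> I \<Longrightarrow> t i \<in> S"
  shows "(\<Oplus>\<^bsub>V\<^esub>i\<in>I. t i) \<in> S" and "\<phi> (\<Oplus>\<^bsub>V\<^esub>i\<in>I. t i) = (\<Sum>i\<in>I. \<phi> (t i))"
proof -
  interpret V: abelian_monoid V by fact
  have "\<phi> \<zero>\<^bsub>V\<^esub> = \<phi> \<zero>\<^bsub>V\<^esub> + \<phi> \<zero>\<^bsub>V\<^esub>"
    using linear_on_add[OF lin S(2) S(2)] by simp
  hence zero: "\<phi> \<zero>\<^bsub>V\<^esub> = 0" by simp
  have "(\<Oplus>\<^bsub>V\<^esub>i\<in>I. t i) \<in> S \<and> \<phi> (\<Oplus>\<^bsub>V\<^esub>i\<in>I. t i) = (\<Sum>i\<in>I. \<phi> (t i))"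
    using I t
  proof (induction I rule: finite_induct)
    case empty
    show ?case using S(2) zero by simp
  next
    case (insert i I)
    have "(\<Oplus>\<^bsub>V\<^esub>j\<in>insert i I. t j) = t i \<oplus>\<^bsub>V\<^esub> (\<Oplus>\<^bsub>V\<^esub>j\<in>I. t j)"
      using insert S(1) by (intro V.finsum_insert) auto
    thus ?case using insert S(3) linear_on_add[OF lin] by simp
  qed
  thus "(\<Oplus>\<^bsub>V\<^esub>i\<in>I. t i) \<in> S" "\<phi> (\<Oplus>\<^bsub>V\<^esub>i\<in>I. t i) = (\<Sum>i\<in>I. \<phi> (t i))" by auto
qed

lemma basis_spans:
  assumes "vectorspace K V" "vectorspace.basis K V B"
  shows "B \<subseteq> carrier V" "module.span K V B = carrier V"
proof -
  interpret vectorspace K V by fact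
  show "B \<subseteq> carrier V" "span B = carrier V" using assms(2) by (auto simp: basis_def)
qed

lemma linear_on_eq_on_basis:
  assumes V: "vectorspace (scalars \<k>) V" and B: "vectorspace.basis (scalars \<k>) V B"
    and lin: "linear_on \<k> V (carrier V) \<phi>" "linear_on \<k> V (carrier V) \<psi>"
    and eq: "\<And>x. x \<in> B \<Longrightarrow> \<phi> x = \<psi> x" and x: "x \<in> carrier V"
  shows "\<phi> x = \<psi> x"
proof -
  interpret V: vectorspace "scalars \<k>" V by fact
  note B' = basis_spans[OF V B]
  have zero: "\<phi> \<zero>\<^bsub>V\<^esub> = 0" "\<psi> \<zero>\<^bsub>V\<^esub> = 0"
    using linear_on_add[OF lin(1), of "\<zero>\<^bsub>V\<^esub>" "\<zero>\<^bsub>V\<^esub>"] linear_on_add[OF lin(2), of "\<zero>\<^bsub>V\<^esub>" "\<zero>\<^bsub>V\<^esub>"]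
    by auto
  have "submodule (scalars \<k>) {x \<in> carrier V. \<phi> x = \<psi> x} V"
    using V.module_axioms zero lin by (auto simp: submodule_def linear_on_add linear_on_smult)
  moreover have "B \<subseteq> {x \<in> carrier V. \<phi> x = \<psi> x}" using B' eq by auto
  ultimately have "V.span B \<subseteq> {x \<in> carrier V. \<phi> x = \<psi> x}" by (intro V.span_is_subset)
  thus ?thesis using x B'(2) by blast
qed

definition coordinates :: "complex set \<Rightarrow> (complex, 'v) module \<Rightarrow> 'v list \<Rightarrow> ('v \<Rightarrow> nat \<Rightarrow> complex) \<Rightarrow> bool"
  where
  "coordinates \<k> V bs co \<longleftrightarrow>
     (\<forall>i<length bs. linear_on \<k> V (carrier V) (\<lambda>x. co x i)) \<and>
     (\<forall>i<length bs. \<forall>x\<in>carrier V. co x i \<in> \<k>) \<and>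
     (\<forall>i<length bs. \<forall>j<length bs. co (bs ! j) i = (if i = j then 1 else 0)) \<and>
     (\<forall>x\<in>carrier V. (\<forall>i<length bs. co x i = 0) \<longrightarrow> x = \<zero>\<^bsub>V\<^esub>)"

lemma coordinates_linear:
    "\<lbrakk>coordinates \<k> V bs co; i < length bs\<rbrakk> \<Longrightarrow> linear_on \<k> V (carrier V) (\<lambda>x. co x i)"
  and coordinates_scalar:
    "\<lbrakk>coordinates \<k> V bs co; i < length bs; x \<in> carrier V\<rbrakk> \<Longrightarrow> co x i \<in> \<k>"
  and coordinates_basis:
    "\<lbrakk>coordinates \<k> V bs co; i < length bs; j < length bs\<rbrakk> \<Longrightarrow> co (bs ! j) i = (if i = j then 1 else 0)"
  and coordinates_eq_zero:
    "\<lbrakk>coordinates \<k> V bs co; x \<in> carrier V; \<And>i. i < length bs \<Longrightarrow> co x i = 0\<rbrakk> \<Longrightarrow> x = \<zero>\<^bsub>V\<^esub>"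
  unfolding coordinates_def by blast+

text \<open>
  The coordinates are the coefficients of the unique expansion in the basis.
\<close>

lemma coordinates_exist:
  assumes V: "vectorspace (scalars \<k>) V" and bs: "distinct bs"
    and B: "vectorspace.basis (scalars \<k>) V (set bs)"
  obtains co where "coordinates \<k> V bs co"
proof -
  interpret V: vectorspace "scalars \<k>" V by fact
  let ?K = "set bs \<rightarrow>\<^sub>E \<k>"
  have sub: "set bs \<subseteq> carrier V" by (rule basis_spans(1)[OF V B])
  have ex1: "\<exists>!a. a \<in> ?K \<and> V.lincomb a (set bs) = x" if "x \<in> carrier V" for x
    using V.basis_criterion[of "set bs"] B sub that by simp
  define cf where "cf x = (THE a. a \<in> ?K \<and> V.lincomb a (set bs) = x)" for x
  have cf: "cf x \<in> ?K" "V.lincomb (cf x) (set bs) = x" if "x \<in> carrier V" for x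
    using theI'[OF ex1[OF that]] unfolding cf_def by auto
  have cf_unique: "cf x = a" if "x \<in> carrier V" "a \<in> ?K" "V.lincomb a (set bs) = x" for x a
    using ex1[OF that(1)] cf[OF that(1)] that by blast
  have cf_eq: "cf x b = a b" if "x \<in> carrier V" "a \<in> set bs \<rightarrow> \<k>" "V.lincomb a (set bs) = x" "b \<in> set bs"
    for x a b
  proof -
    have "V.lincomb (restrict a (set bs)) (set bs) = V.lincomb a (set bs)"
      using that sub by (intro V.lincomb_cong) auto
    hence "cf x = restrict a (set bs)"
      using that by (intro cf_unique) auto
    thus ?thesis using that by simp
  qed
  have closed: "\<kappa> + \<kappa>' \<in> \<k>" "\<kappa> * \<kappa>' \<in> \<k>" "0 \<in> \<k>" "1 \<in> \<k>" if "\<kappa> \<in> \<k>" "\<kappa>' \<in> \<k>" for \<kappa> \<kappa>'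
    using V.R.add.m_closed[of \<kappa> \<kappa>'] V.R.m_closed[of \<kappa> \<kappa>'] V.R.zero_closed V.R.one_closed that by auto
  have inK: "cf x b \<in> \<k>" if "x \<in> carrier V" "b \<in> set bs" for x b
    using cf(1)[OF that(1)] that(2) by auto
  have add: "cf (x \<oplus>\<^bsub>V\<^esub> y) b = cf x b + cf y b"
    if "x \<in> carrier V" "y \<in> carrier V" "b \<in> set bs" for x y b
  proof (rule cf_eq)
    have "V.lincomb (\<lambda>v. cf x v \<oplus>\<^bsub>scalars \<k>\<^esub> cf y v) (set bs) = V.lincomb (cf x) (set bs) \<oplus>\<^bsub>V\<^esub> V.lincomb (cf y) (set bs)"
      using that sub inK by (intro V.lincomb_sum) auto
    thus "V.lincomb (\<lambda>v. cf x v + cf y v) (set bs) = x \<oplus>\<^bsub>V\<^esub> y"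
      using cf(2) that by simp
  qed (use that inK closed in auto)
  have smult: "cf (\<kappa> \<odot>\<^bsub>V\<^esub> x) b = \<kappa> * cf x b"
    if "x \<in> carrier V" "\<kappa> \<in> \<k>" "b \<in> set bs" for x \<kappa> b
  proof (rule cf_eq)
    have "V.lincomb (\<lambda>v. \<kappa> \<otimes>\<^bsub>scalars \<k>\<^esub> cf x v) (set bs) = \<kappa> \<odot>\<^bsub>V\<^esub> V.lincomb (cf x) (set bs)"
      using that sub inK by (intro V.lincomb_smult) auto
    thus "V.lincomb (\<lambda>v. \<kappa> * cf x v) (set bs) = \<kappa> \<odot>\<^bsub>V\<^esub> x"
      using cf(2) that by simp
  qed (use that inK closed in auto)
  have basis_vector: "cf b b' = (if b' = b then 1 else 0)" if b: "b \<in> set bs" "b' \<in> set bs" for b b'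
  proof (rule cf_eq)
    have K: "0 \<in> \<k>" "1 \<in> \<k>" using inK[of b b] closed b sub by auto
    have summand: "(if v = b then 1 else 0) \<odot>\<^bsub>V\<^esub> v = (if b = v then v else \<zero>\<^bsub>V\<^esub>)" if "v \<in> set bs" for v
      using that sub V.smult_one V.lmult_0 by (auto simp: subset_iff)
    have "V.lincomb (\<lambda>v. if v = b then 1 else 0) (set bs) = (\<Oplus>\<^bsub>V\<^esub>v\<in>set bs. if b = v then v else \<zero>\<^bsub>V\<^esub>)"
      unfolding V.lincomb_def using summand sub b by (intro V.finsum_cong') auto
    also have "\<dots> = b"
      using V.finsum_singleton[of b "set bs" "\<lambda>v. v"] b sub by auto
    finally show "V.lincomb (\<lambda>v. if v = b then 1 else 0) (set bs) = b" .
    show "(\<lambda>v. if v = b then 1 else 0) \<in> set bs \<rightarrow> \<k>" using K by auto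
  qed (use b sub in auto)
  have injective: "x = \<zero>\<^bsub>V\<^esub>" if x: "x \<in> carrier V" "\<And>b. b \<in> set bs \<Longrightarrow> cf x b = 0" for x
  proof -
    have "V.lincomb (cf x) (set bs) = (\<Oplus>\<^bsub>V\<^esub>v\<in>set bs. \<zero>\<^bsub>V\<^esub>)"
      unfolding V.lincomb_def using x sub V.lmult_0 by (intro V.finsum_cong') (auto simp: subset_iff)
    thus ?thesis using cf(2)[OF x(1)] by simp
  qed
  show thesis
  proof
    have "cf (bs ! j) (bs ! i) = (if i = j then 1 else 0)" if "i < length bs" "j < length bs" for i j
      using that bs basis_vector[of "bs ! j" "bs ! i"] by (simp add: nth_eq_iff_index_eq)
    moreover have "x = \<zero>\<^bsub>V\<^esub>" if "x \<in> carrier V" "\<forall>i<length bs. cf x (bs ! i) = 0" for x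
      using injective[OF that(1)] that(2) by (metis in_set_conv_nth)
    ultimately show "coordinates \<k> V bs (\<lambda>x i. cf x (bs ! i))"
      unfolding coordinates_def linear_on_def by (simp add: add smult inK)
  qed
qed

section \<open>Modules over an algebra as vector spaces\<close>

context unital_algebra
begin

sublocale vs: vectorspace "scalars \<k>" A by (rule vectorspace)
sublocale alg: ring A by (rule ring)

lemma abelian_monoid: "abelian_monoid A"
  using ring by (simp add: ring_def abelian_group_def)

lemma scalar_divide_closed:
  assumes "\<kappa> \<in> \<k>" "\<kappa>' \<in> \<k>"
  shows "\<kappa> / \<kappa>' \<in> \<k>"
proof (cases "\<kappa>' = 0")
  case True
  thus ?thesis using vs.R.zero_closed by simp
next
  case False
  hence "\<kappa>' \<in> Units (scalars \<k>)"
    using subfield.subfield_Units[OF subfield] assms by auto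
  then obtain y where y: "y \<in> \<k>" "y * \<kappa>' = 1" by (auto simp: Units_def)
  hence "\<kappa> / \<kappa>' = \<kappa> * y" using False by (simp add: field_simps)
  thus ?thesis using vs.R.m_closed[of \<kappa> y] assms(1) y(1) by simp
qed

lemma scalar_one_closed: "\<kappa> \<in> \<k> \<Longrightarrow> \<kappa> \<odot> \<one> \<in> carrier A"
  by (rule vs.smult_closed) auto

lemma scalar_one_mult: "\<lbrakk>\<kappa> \<in> \<k>; x \<in> carrier A\<rbrakk> \<Longrightarrow> (\<kappa> \<odot> \<one>) \<otimes> x = \<kappa> \<odot> x"
  using smult_mult[of \<kappa> \<one> x] by simp

lemma scalar_one_central: "\<lbrakk>\<kappa> \<in> \<k>; x \<in> carrier A\<rbrakk> \<Longrightarrow> x \<otimes> (\<kappa> \<odot> \<one>) = (\<kappa> \<odot> \<one>) \<otimes> x"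
  using mult_smult[of \<kappa> x \<one>] scalar_one_mult[of \<kappa> x] by simp

lemma underlying_space_simps [simp]:
  "carrier (underlying_space A M) = carrier M" "add (underlying_space A M) = add M"
  "zero (underlying_space A M) = zero M" "\<kappa> \<odot>\<^bsub>underlying_space A M\<^esub> x = (\<kappa> \<odot> \<one>) \<odot>\<^bsub>M\<^esub> x"
  by (simp_all add: underlying_space_def)

lemma underlying_vectorspace:
  assumes "left_module A M"
  shows "vectorspace (scalars \<k>) (underlying_space A M)"
proof -
  interpret M: left_module A M by fact
  have "module (scalars \<k>) (underlying_space A M)"
  proof (rule module_criteria)
    show "cring (scalars \<k>)" by (rule vs.is_cring)
    show "\<forall>v\<in>carrier (underlying_space A M). \<exists>neg_v\<in>carrier (underlying_space A M).
        v \<oplus>\<^bsub>underlying_space A M\<^esub> neg_v = \<zero>\<^bsub>underlying_space A M\<^esub>"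
      using M.M.r_neg by (auto intro!: bexI[of _ "\<ominus>\<^bsub>M\<^esub> _"])
    have "((\<kappa> * \<kappa>') \<odot> \<one>) = (\<kappa> \<odot> \<one>) \<otimes> (\<kappa>' \<odot> \<one>)" if "\<kappa> \<in> \<k>" "\<kappa>' \<in> \<k>" for \<kappa> \<kappa>'
      using that vs.smult_assoc1[of \<kappa> \<kappa>' \<one>] scalar_one_mult[of \<kappa> "\<kappa>' \<odot> \<one>"] scalar_one_closed by simp
    thus "\<forall>\<kappa> \<kappa>' v. \<kappa> \<in> carrier (scalars \<k>) \<and> \<kappa>' \<in> carrier (scalars \<k>) \<and> v \<in> carrier (underlying_space A M) \<longrightarrow>
        (\<kappa> \<otimes>\<^bsub>scalars \<k>\<^esub> \<kappa>') \<odot>\<^bsub>underlying_space A M\<^esub> v = \<kappa> \<odot>\<^bsub>underlying_space A M\<^esub> (\<kappa>' \<odot>\<^bsub>underlying_space A M\<^esub> v)"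
      using scalar_one_closed by (simp add: M.smult_assoc)
    have "((\<kappa> + \<kappa>') \<odot> \<one>) = (\<kappa> \<odot> \<one>) \<oplus> (\<kappa>' \<odot> \<one>)" if "\<kappa> \<in> \<k>" "\<kappa>' \<in> \<k>" for \<kappa> \<kappa>'
      using that vs.smult_l_distr[of \<kappa> \<kappa>' \<one>] by simp
    thus "\<forall>\<kappa> \<kappa>' v. \<kappa> \<in> carrier (scalars \<k>) \<and> \<kappa>' \<in> carrier (scalars \<k>) \<and> v \<in> carrier (underlying_space A M) \<longrightarrow>
        (\<kappa> \<oplus>\<^bsub>scalars \<k>\<^esub> \<kappa>') \<odot>\<^bsub>underlying_space A M\<^esub> v =
        \<kappa> \<odot>\<^bsub>underlying_space A M\<^esub> v \<oplus>\<^bsub>underlying_space A M\<^esub> \<kappa>' \<odot>\<^bsub>underlying_space A M\<^esub> v"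
      using scalar_one_closed by (simp add: M.smult_l_distr)
    have "1 \<odot> \<one> = \<one>" using vs.smult_one[of \<one>] by simp
    thus "\<forall>v\<in>carrier (underlying_space A M). \<one>\<^bsub>scalars \<k>\<^esub> \<odot>\<^bsub>underlying_space A M\<^esub> v = v"
      by (simp add: M.smult_one)
  qed (use M.smult_closed M.smult_r_distr scalar_one_closed M.M.a_assoc M.M.a_comm in auto)
  thus ?thesis
    using vs.field_axioms by (simp add: vectorspace_def)
qed

text \<open>
  Scalars act through central elements of the algebra, so they commute with \<open>r\<close>.
\<close>

lemma action_linear_on:
  assumes "left_module A M" and r: "r \<in> carrier A"
    and lin: "linear_on \<k> (underlying_space A M) (carrier M) \<phi>"
  shows "linear_on \<k> (underlying_space A M) (carrier M) (\<lambda>x. \<phi> (r \<odot>\<^bsub>M\<^esub> x))"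
proof -
  interpret M: left_module A M by fact
  have "r \<odot>\<^bsub>M\<^esub> ((\<kappa> \<odot> \<one>) \<odot>\<^bsub>M\<^esub> x) = (\<kappa> \<odot> \<one>) \<odot>\<^bsub>M\<^esub> (r \<odot>\<^bsub>M\<^esub> x)" if "\<kappa> \<in> \<k>" "x \<in> carrier M" for \<kappa> x
    using that r scalar_one_closed M.smult_assoc scalar_one_central by metis
  thus ?thesis
    using lin r by (simp add: linear_on_def M.smult_r_distr M.smult_closed)
qed

lemma action_in_coordinates:
  assumes M: "left_module A M" and r: "r \<in> carrier A"
    and D: "action_matrix \<k> A M bs r D" and co: "coordinates \<k> (underlying_space A M) bs co"
    and x: "x \<in> carrier M" and i: "i < length bs"
  shows "co (r \<odot>\<^bsub>M\<^esub> x) i = (\<Sum>j<length bs. D $$ (i, j) * co x j)"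
proof -
  interpret M: left_module A M by fact
  let ?V = "underlying_space A M"
  interpret V: vectorspace "scalars \<k>" ?V by (rule underlying_vectorspace[OF M])
  have lin: "linear_on \<k> ?V (carrier M) (\<lambda>x. co x j)" if "j < length bs" for j
    using coordinates_linear[OF co that] by simp
  have DK: "D $$ (k, l) \<in> \<k>" if "k < length bs" "l < length bs" for k l
  proof -
    have "D \<in> carrier_mat (length bs) (length bs)" "elements_mat D \<subseteq> \<k>"
      using D unfolding action_matrix_def by blast+
    thus ?thesis using that elements_matI by blast
  qed
  have Bs: "vectorspace.basis (scalars \<k>) ?V (set bs)"
    using D unfolding action_matrix_def ordered_basis_def by blast
  have sub: "set bs \<subseteq> carrier M"
    using basis_spans(1)[OF V.vectorspace_axioms Bs] by simp
  have "co (r \<odot>\<^bsub>M\<^esub> b) i = (\<Sum>j<length bs. D $$ (i, j) * co b j)" if b: "b \<in> set bs" for b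
  proof -
    obtain j where j: "j < length bs" "b = bs ! j" using b by (auto simp: in_set_conv_nth)
    have "r \<odot>\<^bsub>M\<^esub> b = (\<Oplus>\<^bsub>?V\<^esub>k\<in>{..<length bs}. D $$ (k, j) \<odot>\<^bsub>?V\<^esub> bs ! k)"
      using D j by (simp add: action_matrix_def)
    also have "co \<dots> i = (\<Sum>k<length bs. co (D $$ (k, j) \<odot>\<^bsub>?V\<^esub> bs ! k) i)"
      using lin[OF i] sub DK j V.abelian_monoid_axioms
      by (intro linear_on_finsum(2)[where S = "carrier M"] M.M.a_closed)
        (auto intro!: M.smult_closed scalar_one_closed)
    also have "\<dots> = (\<Sum>k<length bs. D $$ (k, j) * co (bs ! k) i)"
      using sub DK j by (intro sum.cong refl linear_on_smult[OF lin[OF i]]) auto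
    also have "\<dots> = (\<Sum>k<length bs. if k = i then D $$ (k, j) else 0)"
      using i by (intro sum.cong refl) (simp add: coordinates_basis[OF co])
    also have "\<dots> = D $$ (i, j)" using i by simp
    also have "\<dots> = (\<Sum>k<length bs. if k = j then D $$ (i, k) else 0)" using j by simp
    also have "\<dots> = (\<Sum>k<length bs. D $$ (i, k) * co b k)"
      using j by (intro sum.cong refl) (simp add: coordinates_basis[OF co])
    finally show ?thesis .
  qed
  moreover have "linear_on \<k> ?V (carrier ?V) (\<lambda>x. co (r \<odot>\<^bsub>M\<^esub> x) i)"
    using action_linear_on[OF M r lin[OF i]] by simp
  moreover have "linear_on \<k> ?V (carrier ?V) (\<lambda>x. \<Sum>j<length bs. D $$ (i, j) * co x j)"
    using lin by (intro linear_on_combination) auto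
  ultimately show ?thesis
    using linear_on_eq_on_basis[OF V.vectorspace_axioms Bs, of "\<lambda>x. co (r \<odot>\<^bsub>M\<^esub> x) i"
      "\<lambda>x. \<Sum>j<length bs. D $$ (i, j) * co x j" x] x by simp
qed

text \<open>
  A left eigenvector of the matrix of \<open>r\<close> is the coordinate vector of an eigenfunctional.
  Functionals, unlike eigenvectors, exist without extending the scalars of the module.
\<close>

lemma eigenvalue_functional:
  assumes M: "left_module A M" and r: "r \<in> carrier A" and ev: "action_eigenvalue \<k> A M r \<nu>"
  obtains \<phi> where "linear_on \<k> (underlying_space A M) (carrier M) \<phi>"
    "\<And>x. x \<in> carrier M \<Longrightarrow> \<phi> (r \<odot>\<^bsub>M\<^esub> x) = \<nu> * \<phi> x" "\<exists>x\<in>carrier M. \<phi> x \<noteq> 0"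
proof -
  obtain bs D where D: "action_matrix \<k> A M bs r D" and eig: "eigenvalue D \<nu>"
    using ev by (auto simp: action_eigenvalue_def)
  let ?V = "underlying_space A M" and ?m = "length bs"
  interpret V: vectorspace "scalars \<k>" ?V by (rule underlying_vectorspace[OF M])
  have basis: "distinct bs" "vectorspace.basis (scalars \<k>) ?V (set bs)"
    and Dc: "D \<in> carrier_mat ?m ?m"
    using D unfolding action_matrix_def ordered_basis_def by blast+
  obtain co where co: "coordinates \<k> ?V bs co"
    using coordinates_exist[OF V.vectorspace_axioms basis] .
  obtain f where f: "\<exists>i<?m. f i \<noteq> 0" "\<And>j. j < ?m \<Longrightarrow> (\<Sum>i<?m. f i * D $$ (i, j)) = \<nu> * f j"
    using left_eigenvector_exists[OF Dc eig] by blast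
  define \<phi> where "\<phi> x = (\<Sum>i<?m. f i * co x i)" for x
  show thesis
  proof
    show "linear_on \<k> ?V (carrier M) \<phi>"
      unfolding \<phi>_def using coordinates_linear[OF co] by (intro linear_on_combination) simp
    show "\<phi> (r \<odot>\<^bsub>M\<^esub> x) = \<nu> * \<phi> x" if x: "x \<in> carrier M" for x
    proof -
      have "\<phi> (r \<odot>\<^bsub>M\<^esub> x) = (\<Sum>i<?m. \<Sum>j<?m. f i * (D $$ (i, j) * co x j))"
        by (simp add: \<phi>_def action_in_coordinates[OF M r D co x] sum_distrib_left)
      also have "\<dots> = (\<Sum>j<?m. (\<Sum>i<?m. f i * D $$ (i, j)) * co x j)"
        by (subst sum.swap) (simp add: sum_distrib_right mult.assoc)
      also have "\<dots> = \<nu> * \<phi> x"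
        by (simp add: f(2) \<phi>_def sum_distrib_left mult.assoc)
      finally show ?thesis .
    qed
    obtain j where j: "j < ?m" "f j \<noteq> 0" using f(1) by blast
    have "\<phi> (bs ! j) = (\<Sum>i<?m. if i = j then f i else 0)"
      unfolding \<phi>_def using j by (intro sum.cong refl) (simp add: coordinates_basis[OF co])
    hence "\<phi> (bs ! j) \<noteq> 0" using j by simp
    moreover have "bs ! j \<in> carrier M" using basis_spans(1)[OF V.vectorspace_axioms basis(2)] j by auto
    ultimately show "\<exists>x\<in>carrier M. \<phi> x \<noteq> 0" by blast
  qed
qed

end

section \<open>Subquotients detected by a dominant functional\<close>

context unital_algebra
begin

text \<open>
  \<open>W\<close> is the functional of a left Perron-Frobenius eigenvector; the last clause is the multiplicity one
  of its eigenvalue. It is asked on every submodule, because it is applied to functionals pulled back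
  from subquotients, for which an extension to an eigenfunctional on \<open>M\<close> is not known in advance.
\<close>

definition dominant_functional ::
    "('a, 'm) module \<Rightarrow> 'a \<Rightarrow> complex \<Rightarrow> ('m \<Rightarrow> complex) \<Rightarrow> bool" where
  "dominant_functional M r \<mu> W \<longleftrightarrow>
     linear_on \<k> (underlying_space A M) (carrier M) W \<and>
     (\<forall>x\<in>carrier M. W (r \<odot>\<^bsub>M\<^esub> x) = \<mu> * W x) \<and>
     (\<forall>P \<phi>. Module.submodule P A M \<and> linear_on \<k> (underlying_space A M) P \<phi> \<and>
        (\<forall>x\<in>P. \<phi> (r \<odot>\<^bsub>M\<^esub> x) = \<mu> * \<phi> x) \<longrightarrow> (\<exists>t. \<forall>x\<in>P. \<phi> x = t * W x))"

lemma linear_on_minus: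
  assumes M: "left_module A M" and P: "Module.submodule P A M"
    and lin: "linear_on \<k> (underlying_space A M) P \<phi>" and xy: "x \<in> P" "y \<in> P"
  shows "\<phi> (x \<ominus>\<^bsub>M\<^esub> y) = \<phi> x - \<phi> y"
proof -
  interpret M: left_module A M by fact
  note PM = M.submoduleD[OF P]
  have "x \<ominus>\<^bsub>M\<^esub> y \<oplus>\<^bsub>M\<^esub> y = x"
    using xy PM(1) by (simp add: a_minus_def M.M.a_assoc M.M.l_neg subset_iff)
  thus ?thesis using linear_on_add[OF lin, of "x \<ominus>\<^bsub>M\<^esub> y" y] xy PM(6) by simp
qed

lemma linear_on_in_coordinates:
  assumes M: "left_module A M" and co: "coordinates \<k> (underlying_space A M) bs co"
    and P: "Module.submodule P A M" and lin: "linear_on \<k> (underlying_space A M) P \<phi>"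
  obtains f where "\<And>x. x \<in> P \<Longrightarrow> \<phi> x = (\<Sum>i<length bs. f i * co x i)"
proof -
  interpret M: left_module A M by fact
  note PM = M.submoduleD[OF P]
  have lco: "linear_on \<k> (underlying_space A M) P (\<lambda>x. co x i)" if "i < length bs" for i
    by (rule linear_on_subset[OF _ PM(1)]) (use coordinates_linear[OF co that] in simp)
  show thesis
  proof (rule functional_in_coordinates[where S = P and co = co and \<phi> = \<phi> and \<k> = \<k> and m = "length bs"])
    fix x y \<kappa> assume x: "x \<in> P" and y: "y \<in> P" and \<kappa>: "\<kappa> \<in> \<k>"
    have ky: "(\<kappa> \<odot> \<one>) \<odot>\<^bsub>M\<^esub> y \<in> P" using PM(4) y scalar_one_closed \<kappa> by simp
    have "\<psi> (x \<ominus>\<^bsub>M\<^esub> (\<kappa> \<odot> \<one>) \<odot>\<^bsub>M\<^esub> y) = \<psi> x - \<kappa> * \<psi> y"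
      if "linear_on \<k> (underlying_space A M) P \<psi>" for \<psi>
      using linear_on_minus[OF M P that x ky] linear_on_smult[OF that \<kappa> y] by simp
    thus "\<exists>z\<in>P. (\<forall>i<length bs. co z i = co x i - \<kappa> * co y i) \<and> \<phi> z = \<phi> x - \<kappa> * \<phi> y"
      using lco lin PM(6)[OF x ky] by (intro bexI[of _ "x \<ominus>\<^bsub>M\<^esub> (\<kappa> \<odot> \<one>) \<odot>\<^bsub>M\<^esub> y"]) auto
  next
    fix x i assume "x \<in> P" "i < length bs"
    thus "co x i \<in> \<k>" using coordinates_scalar[OF co, of i x] PM(1) by auto
  next
    fix x assume x: "x \<in> P" "\<And>i. i < length bs \<Longrightarrow> co x i = 0"
    hence "x = \<zero>\<^bsub>M\<^esub>" using coordinates_eq_zero[OF co, of x] PM(1) by auto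
    thus "\<phi> x = 0" using linear_on_add[OF lin PM(2) PM(2)] by simp
  qed (use that scalar_divide_closed in auto)
qed

text \<open>
  The last claim compares the functionals of two positive elements: if a functional with positive
  coordinates \<open>g\<close> vanishes on \<open>P\<close>, then there it is an eigenfunctional of \<open>r\<close> and therefore equals
  \<open>(g \<cdot> v) W\<close>, where \<open>g \<cdot> v > 0\<close>.
\<close>

lemma perron_functional:
  assumes M: "left_module A M" and r: "r \<in> carrier A"
    and D: "action_matrix \<k> A M bs r D" and co: "coordinates \<k> (underlying_space A M) bs co"
    and real: "\<And>i j. i < length bs \<Longrightarrow> j < length bs \<Longrightarrow> D $$ (i, j) = complex_of_real (d i j)"
    and pos: "\<And>i j. i < length bs \<Longrightarrow> j < length bs \<Longrightarrow> 0 < d i j"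
    and pf: "perron_frobenius_eigenvalue D \<mu>"
  obtains w :: "nat \<Rightarrow> real" where "\<And>i. i < length bs \<Longrightarrow> 0 < w i"
    "dominant_functional M r (of_real \<mu>) (\<lambda>x. \<Sum>i<length bs. of_real (w i) * co x i)"
    "\<And>P g x. \<lbrakk>Module.submodule P A M; \<And>i. i < length bs \<Longrightarrow> 0 < (g i :: real);
      \<And>x. x \<in> P \<Longrightarrow> (\<Sum>i<length bs. of_real (g i) * co x i) = 0; x \<in> P\<rbrakk>
      \<Longrightarrow> (\<Sum>i<length bs. of_real (w i) * co x i) = 0"
proof -
  interpret M: left_module A M by fact
  let ?m = "length bs"
  have Dc: "D \<in> carrier_mat ?m ?m" using D unfolding action_matrix_def by blast
  have mu: "0 < \<mu>" using pf by (simp add: perron_frobenius_eigenvalue_def)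
  obtain v w where vw: "\<And>i. i < ?m \<Longrightarrow> 0 < v i" "\<And>i. i < ?m \<Longrightarrow> 0 < w i"
    "\<And>i. i < ?m \<Longrightarrow> (\<Sum>j<?m. d i j * v j) = \<mu> * v i"
    "\<And>j. j < ?m \<Longrightarrow> (\<Sum>i<?m. w i * d i j) = \<mu> * w j" "(\<Sum>i<?m. w i * v i) = 1"
    using perron_frobenius_vectors[OF Dc real pos pf] by blast
  define W where "W x = (\<Sum>i<?m. of_real (w i) * co x i)" for x
  have matrix: "co (r \<odot>\<^bsub>M\<^esub> x) i = (\<Sum>j<?m. of_real (d i j) * co x j)"
    if "x \<in> carrier M" "i < ?m" for x i
    unfolding action_in_coordinates[OF M r D co that]
    by (intro sum.cong refl) (simp add: real[OF that(2)])
  have multiple: "\<phi> x = (\<Sum>i<?m. f i * of_real (v i)) * W x"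
    if P: "Module.submodule P A M" and f: "\<And>x. x \<in> P \<Longrightarrow> \<phi> x = (\<Sum>i<?m. f i * co x i)"
      and eig: "\<And>x. x \<in> P \<Longrightarrow> \<phi> (r \<odot>\<^bsub>M\<^esub> x) = of_real \<mu> * \<phi> x" and x: "x \<in> P" for P \<phi> f x
    unfolding W_def
  proof (rule eigenfunctional_multiple[where S = P and T = "\<lambda>x. r \<odot>\<^bsub>M\<^esub> x" and d = d and \<mu> = \<mu>])
    show "r \<odot>\<^bsub>M\<^esub> x \<in> P" if "x \<in> P" for x using M.submoduleD(4)[OF P r that] .
    show "co (r \<odot>\<^bsub>M\<^esub> x) i = (\<Sum>j<?m. of_real (d i j) * co x j)" if "x \<in> P" "i < ?m" for x i
      using matrix M.submoduleD(1)[OF P] that by blast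
  qed (use vw mu pos f eig x in auto)
  have linW: "linear_on \<k> (underlying_space A M) (carrier M) W"
    unfolding W_def using coordinates_linear[OF co] by (intro linear_on_combination) simp
  have eigW: "W (r \<odot>\<^bsub>M\<^esub> x) = of_real \<mu> * W x" if "x \<in> carrier M" for x
  proof -
    have "W (r \<odot>\<^bsub>M\<^esub> x) = (\<Sum>i<?m. \<Sum>j<?m. of_real (w i) * (of_real (d i j) * co x j))"
      by (simp add: W_def matrix[OF that] sum_distrib_left)
    also have "\<dots> = (\<Sum>j<?m. of_real (\<Sum>i<?m. w i * d i j) * co x j)"
      by (subst sum.swap) (simp add: sum_distrib_right mult.assoc)
    also have "\<dots> = (\<Sum>j<?m. of_real \<mu> * of_real (w j) * co x j)"
      by (intro sum.cong refl) (simp only: vw(4) lessThan_iff of_real_mult)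
    finally show ?thesis by (simp add: W_def sum_distrib_left mult.assoc)
  qed
  show thesis
  proof
    show "0 < w i" if "i < ?m" for i using vw that by simp
    have "\<exists>t. \<forall>x\<in>P. \<phi> x = t * W x"
      if P: "Module.submodule P A M" and lin: "linear_on \<k> (underlying_space A M) P \<phi>"
        and eig: "\<forall>x\<in>P. \<phi> (r \<odot>\<^bsub>M\<^esub> x) = of_real \<mu> * \<phi> x" for P \<phi>
    proof -
      obtain f where "\<And>x. x \<in> P \<Longrightarrow> \<phi> x = (\<Sum>i<?m. f i * co x i)"
        using linear_on_in_coordinates[OF M co P lin] by blast
      thus ?thesis using multiple[OF P] eig by blast
    qed
    thus "dominant_functional M r (of_real \<mu>) (\<lambda>x. \<Sum>i<?m. of_real (w i) * co x i)"
      unfolding W_def[symmetric] dominant_functional_def using linW eigW by blast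
    show "(\<Sum>i<?m. of_real (w i) * co x i) = 0"
      if P: "Module.submodule P A M" and g: "\<And>i. i < ?m \<Longrightarrow> 0 < (g i :: real)"
        and 0: "\<And>x. x \<in> P \<Longrightarrow> (\<Sum>i<?m. of_real (g i) * co x i) = 0" and x: "x \<in> P" for P g x
    proof -
      have "0 = (\<Sum>i<?m. of_real (g i) * of_real (v i)) * W x"
        using multiple[OF P, of "\<lambda>_. 0" "\<lambda>i. of_real (g i)" x] 0 x by simp
      moreover have "?m \<noteq> 0" using vw(5) by (cases ?m) auto
      hence "0 < (\<Sum>i<?m. g i * v i)" using g vw(1) by (intro sum_pos) auto
      moreover have "(\<Sum>i<?m. complex_of_real (g i) * of_real (v i)) = of_real (\<Sum>i<?m. g i * v i)"
        by simp
      ultimately have "of_real (\<Sum>i<?m. g i * v i) * W x = 0" "(\<Sum>i<?m. g i * v i) \<noteq> 0"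
        by (simp_all only: less_irrefl)
      thus ?thesis unfolding W_def[symmetric] by (simp only: mult_eq_0_iff of_real_eq_0_iff) simp
    qed
  qed
qed

text \<open>
  An eigenfunctional on \<open>P / Q\<close> pulls back to a nonzero multiple of \<open>W\<close> on \<open>P\<close>.
\<close>

lemma dominant_functional_on_subquotient:
  assumes M: "left_module A M" and r: "r \<in> carrier A"
    and W: "dominant_functional M r \<mu> W"
    and P: "Module.submodule P A M" and Q: "Module.submodule Q A M" and QP: "Q \<subseteq> P"
    and X: "X = quotient_module (M\<lparr>carrier := P\<rparr>) Q"
    and ev: "action_eigenvalue \<k> A X r \<mu>"
  shows "\<And>x. x \<in> Q \<Longrightarrow> W x = 0" and "\<exists>x\<in>P. W x \<noteq> 0"
proof -
  interpret M: left_module A M by fact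
  note sq = M.subquotient_simps[OF P Q QP X]
  interpret Q: abelian_subgroup Q M by (rule M.submodule_abelian_subgroup[OF Q])
  obtain \<phi> where \<phi>: "linear_on \<k> (underlying_space A X) (carrier X) \<phi>"
    "\<And>x. x \<in> carrier X \<Longrightarrow> \<phi> (r \<odot>\<^bsub>X\<^esub> x) = \<mu> * \<phi> x" "\<exists>x\<in>carrier X. \<phi> x \<noteq> 0"
    using eigenvalue_functional[OF sq(1) r ev] by blast
  define \<psi> where "\<psi> x = \<phi> (Q +>\<^bsub>M\<^esub> x)" for x
  have in_X: "Q +>\<^bsub>M\<^esub> x \<in> carrier X" if "x \<in> P" for x using that by (simp add: sq(2))
  have "linear_on \<k> (underlying_space A M) P \<psi>"
    using linear_on_add[OF \<phi>(1)] linear_on_smult[OF \<phi>(1)] in_X scalar_one_closed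
    unfolding linear_on_def \<psi>_def by (auto simp: sq(4,5)[symmetric])
  moreover have "\<forall>x\<in>P. \<psi> (r \<odot>\<^bsub>M\<^esub> x) = \<mu> * \<psi> x"
    using \<phi>(2) in_X r by (auto simp: \<psi>_def sq(5)[symmetric])
  ultimately obtain t where t: "\<And>x. x \<in> P \<Longrightarrow> \<psi> x = t * W x"
    using W P unfolding dominant_functional_def by blast
  obtain x where x: "x \<in> P" "\<psi> x \<noteq> 0" using \<phi>(3) by (auto simp: sq(2) \<psi>_def)
  hence "t \<noteq> 0" "W x \<noteq> 0" using t[OF x(1)] by auto
  thus "\<exists>x\<in>P. W x \<noteq> 0" using x by blast
  interpret X: left_module A X by (rule sq(1))
  show "W y = 0" if y: "y \<in> Q" for y
  proof -
    have "\<psi> y = \<phi> \<zero>\<^bsub>X\<^esub>" using Q.a_rcos_const[OF y] by (simp add: \<psi>_def sq(3))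
    moreover have "\<phi> \<zero>\<^bsub>X\<^esub> = 0" using linear_on_add[OF \<phi>(1), of "\<zero>\<^bsub>X\<^esub>" "\<zero>\<^bsub>X\<^esub>"] by simp
    ultimately show ?thesis using t[of y] \<open>t \<noteq> 0\<close> y QP by auto
  qed
qed

text \<open>
  If \<open>W\<close> vanished on \<open>P \<inter> P'\<close>, then \<open>x + y \<mapsto> W x\<close> would be well defined on \<open>P + P'\<close>, and it would be
  an eigenfunctional that vanishes on \<open>P'\<close> but not on \<open>P\<close>.
\<close>

lemma dominant_functional_inter:
  assumes M: "left_module A M" and r: "r \<in> carrier A" and W: "dominant_functional M r \<mu> W"
    and P: "Module.submodule P A M" and P': "Module.submodule P' A M"
    and nz: "\<exists>x\<in>P. W x \<noteq> 0" "\<exists>x\<in>P'. W x \<noteq> 0"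
  shows "\<exists>x\<in>P \<inter> P'. W x \<noteq> 0"
proof (rule ccontr)
  assume "\<not> (\<exists>x\<in>P \<inter> P'. W x \<noteq> 0)"
  hence zero: "W x = 0" if "x \<in> P" "x \<in> P'" for x using that by blast
  interpret M: left_module A M by fact
  note p = M.submoduleD[OF P] and p' = M.submoduleD[OF P']
  have linW: "linear_on \<k> (underlying_space A M) (carrier M) W"
    and eigW: "\<And>x. x \<in> carrier M \<Longrightarrow> W (r \<odot>\<^bsub>M\<^esub> x) = \<mu> * W x"
    using W by (auto simp: dominant_functional_def)
  have carr: "Module.submodule (carrier M) A M"
    using M.smult_closed by (intro M.submoduleI) auto
  define S where "S = {x \<oplus>\<^bsub>M\<^esub> y | x y. x \<in> P \<and> y \<in> P'}"
  define \<phi> where "\<phi> z = W (SOME x. x \<in> P \<and> (\<exists>y\<in>P'. z = x \<oplus>\<^bsub>M\<^esub> y))" for z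
  have \<phi>: "\<phi> (x \<oplus>\<^bsub>M\<^esub> y) = W x" if x: "x \<in> P" and y: "y \<in> P'" for x y
  proof -
    let ?Q = "\<lambda>u. u \<in> P \<and> (\<exists>y'\<in>P'. x \<oplus>\<^bsub>M\<^esub> y = u \<oplus>\<^bsub>M\<^esub> y')"
    define u where "u = (SOME u. ?Q u)"
    have "?Q u" unfolding u_def by (rule someI[of ?Q x]) (use x y in blast)
    then obtain y' where u: "u \<in> P" "y' \<in> P'" "x \<oplus>\<^bsub>M\<^esub> y = u \<oplus>\<^bsub>M\<^esub> y'" by blast
    have c: "x \<in> carrier M" "y \<in> carrier M" "u \<in> carrier M" "y' \<in> carrier M"
      using x y u p(1) p'(1) by auto
    have "x \<ominus>\<^bsub>M\<^esub> u = x \<oplus>\<^bsub>M\<^esub> y \<oplus>\<^bsub>M\<^esub> (\<ominus>\<^bsub>M\<^esub> y \<ominus>\<^bsub>M\<^esub> u)"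
      using c M.M.a_lcomm[of y "\<ominus>\<^bsub>M\<^esub> u" "\<ominus>\<^bsub>M\<^esub> y"]
      by (simp add: a_minus_def M.M.a_ac M.M.r_neg)
    also have "\<dots> = y' \<ominus>\<^bsub>M\<^esub> y"
      unfolding u(3) using c M.M.a_lcomm[of u y' "\<ominus>\<^bsub>M\<^esub> u \<oplus>\<^bsub>M\<^esub> \<ominus>\<^bsub>M\<^esub> y"]
      by (simp add: a_minus_def M.M.a_ac M.M.r_neg2)
    finally have "x \<ominus>\<^bsub>M\<^esub> u = y' \<ominus>\<^bsub>M\<^esub> y" .
    hence "W (x \<ominus>\<^bsub>M\<^esub> u) = 0" using p(6)[OF x u(1)] p'(6)[OF u(2) y] by (metis zero)
    hence "W x = W u" using linear_on_minus[OF M carr linW c(1) c(3)] by simp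
    thus ?thesis by (simp add: \<phi>_def u_def)
  qed
  \<comment> \<open>The second addend of a sum in \<open>P + P'\<close> never contributes to \<open>\<phi>\<close>, so all laws reduce to those of \<open>W\<close>.\<close>
  have closed: "(x \<oplus>\<^bsub>M\<^esub> y) \<oplus>\<^bsub>M\<^esub> (x' \<oplus>\<^bsub>M\<^esub> y') = (x \<oplus>\<^bsub>M\<^esub> x') \<oplus>\<^bsub>M\<^esub> (y \<oplus>\<^bsub>M\<^esub> y')"
    "s \<odot>\<^bsub>M\<^esub> (x \<oplus>\<^bsub>M\<^esub> y) = s \<odot>\<^bsub>M\<^esub> x \<oplus>\<^bsub>M\<^esub> s \<odot>\<^bsub>M\<^esub> y"
    if "x \<in> P" "y \<in> P'" "x' \<in> P" "y' \<in> P'" "s \<in> carrier A" for x y x' y' s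
    using that p(1) p'(1) by (simp_all add: M.M.a_ac M.smult_r_distr subset_iff)
  have S: "Module.submodule S A M"
  proof (rule M.submoduleI)
    show "S \<subseteq> carrier M" using p(1) p'(1) by (auto simp: S_def)
    show "\<zero>\<^bsub>M\<^esub> \<in> S" using p(2) p'(2) unfolding S_def by (auto intro!: exI[of _ "\<zero>\<^bsub>M\<^esub>"])
    fix z z' assume "z \<in> S" "z' \<in> S"
    then obtain x y x' y' where *: "x \<in> P" "y \<in> P'" "x' \<in> P" "y' \<in> P'" "z = x \<oplus>\<^bsub>M\<^esub> y" "z' = x' \<oplus>\<^bsub>M\<^esub> y'"
      by (auto simp: S_def)
    thus "z \<oplus>\<^bsub>M\<^esub> z' \<in> S"
      using closed(1)[OF *(1-4) r] p(3)[OF *(1,3)] p'(3)[OF *(2,4)] unfolding S_def by blast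
  next
    fix s z assume s: "s \<in> carrier A" and "z \<in> S"
    then obtain x y where *: "x \<in> P" "y \<in> P'" "z = x \<oplus>\<^bsub>M\<^esub> y" by (auto simp: S_def)
    thus "s \<odot>\<^bsub>M\<^esub> z \<in> S"
      using closed(2)[OF *(1,2,1,2) s] p(4)[OF s *(1)] p'(4)[OF s *(2)] unfolding S_def by blast
  qed
  have act: "\<phi> (s \<odot>\<^bsub>M\<^esub> (x \<oplus>\<^bsub>M\<^esub> y)) = W (s \<odot>\<^bsub>M\<^esub> x)"
    if "s \<in> carrier A" "x \<in> P" "y \<in> P'" for s x y
    using closed(2)[OF that(2,3,2,3,1)] \<phi>[OF p(4)[OF that(1,2)] p'(4)[OF that(1,3)]] by simp
  have "linear_on \<k> (underlying_space A M) S \<phi>"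
    unfolding linear_on_def
  proof (intro conjI ballI)
    fix z z' assume "z \<in> S" "z' \<in> S"
    then obtain x y x' y' where *: "x \<in> P" "y \<in> P'" "x' \<in> P" "y' \<in> P'" "z = x \<oplus>\<^bsub>M\<^esub> y" "z' = x' \<oplus>\<^bsub>M\<^esub> y'"
      by (auto simp: S_def)
    have "W (x \<oplus>\<^bsub>M\<^esub> x') = W x + W x'"
      using linear_on_add[OF linW, of x x'] * p(1) by auto
    thus "\<phi> (z \<oplus>\<^bsub>underlying_space A M\<^esub> z') = \<phi> z + \<phi> z'"
      using closed(1)[OF *(1-4) r] \<phi> * p(3)[OF *(1,3)] p'(3)[OF *(2,4)] by simp
  next
    fix \<kappa> z assume \<kappa>: "\<kappa> \<in> \<k>" and "z \<in> S"
    then obtain x y where *: "x \<in> P" "y \<in> P'" "z = x \<oplus>\<^bsub>M\<^esub> y" by (auto simp: S_def)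
    thus "\<phi> (\<kappa> \<odot>\<^bsub>underlying_space A M\<^esub> z) = \<kappa> * \<phi> z"
      using act[OF scalar_one_closed[OF \<kappa>] *(1,2)] \<phi>[OF *(1,2)] linear_on_smult[OF linW \<kappa>, of x] p(1)
      by auto
  qed
  moreover have "\<forall>z\<in>S. \<phi> (r \<odot>\<^bsub>M\<^esub> z) = \<mu> * \<phi> z"
    using act[OF r] \<phi> eigW p(1) by (auto simp: S_def)
  ultimately obtain t where t: "\<And>z. z \<in> S \<Longrightarrow> \<phi> z = t * W z"
    using W S unfolding dominant_functional_def by blast
  have PS: "x \<in> S" "\<phi> x = W x" if x: "x \<in> P" for x
  proof -
    have "x = x \<oplus>\<^bsub>M\<^esub> \<zero>\<^bsub>M\<^esub>" using x p(1) by (simp add: subset_iff)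
    thus "x \<in> S" "\<phi> x = W x" using \<phi>[OF x p'(2)] x p'(2) unfolding S_def by auto
  qed
  have P'S: "y \<in> S" "\<phi> y = 0" if y: "y \<in> P'" for y
  proof -
    have "y = \<zero>\<^bsub>M\<^esub> \<oplus>\<^bsub>M\<^esub> y" using y p'(1) by (simp add: subset_iff)
    thus "y \<in> S" "\<phi> y = 0" using \<phi>[OF p(2) y] y p(2) zero[OF p(2) p'(2)] unfolding S_def by auto
  qed
  obtain y where "y \<in> P'" "W y \<noteq> 0" using nz(2) by blast
  hence "t = 0" using t[OF P'S(1)] P'S(2) by auto
  thus False using nz(1) t PS by auto
qed

text \<open>
  Put \<open>R = P \<inter> P'\<close>. As \<open>W\<close> does not vanish on \<open>R\<close>, simplicity gives \<open>P = R + Q\<close> and \<open>P' = R + Q'\<close>.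
  As \<open>W\<close> vanishes on \<open>R \<inter> Q\<close>, this submodule cannot map onto \<open>P' / Q'\<close>, so it lies in \<open>Q'\<close>; by
  symmetry \<open>R \<inter> Q = R \<inter> Q'\<close>. Hence \<open>P / Q \<cong> R / (R \<inter> Q) \<cong> P' / Q'\<close>.
\<close>

lemma special_subquotients_isomorphic:
  assumes M: "left_module A M" and r: "r \<in> carrier A" and W: "dominant_functional M r \<mu> W"
    and P: "Module.submodule P A M" and Q: "Module.submodule Q A M" and QP: "Q \<subseteq> P"
    and X: "X = quotient_module (M\<lparr>carrier := P\<rparr>) Q" and simple: "simple_module A X"
    and WP: "\<exists>x\<in>P. W x \<noteq> 0" and WQ: "\<And>x. x \<in> Q \<Longrightarrow> W x = 0"
    and P': "Module.submodule P' A M" and Q': "Module.submodule Q' A M" and QP': "Q' \<subseteq> P'"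
    and X': "X' = quotient_module (M\<lparr>carrier := P'\<rparr>) Q'" and simple': "simple_module A X'"
    and WP': "\<exists>x\<in>P'. W x \<noteq> 0" and WQ': "\<And>x. x \<in> Q' \<Longrightarrow> W x = 0"
  shows "isomorphic_modules A X X'"
proof -
  interpret M: left_module A M by fact
  note p = M.submoduleD[OF P] and p' = M.submoduleD[OF P']
  note q = M.submoduleD[OF Q] and q' = M.submoduleD[OF Q']
  note sq = M.subquotient_simps[OF P Q QP X] and sq' = M.subquotient_simps[OF P' Q' QP' X']
  have linW: "linear_on \<k> (underlying_space A M) (carrier M) W"
    using W by (simp add: dominant_functional_def)
  have carr: "Module.submodule (carrier M) A M"
    using M.smult_closed by (intro M.submoduleI) auto
  have inter: "Module.submodule (H \<inter> K) A M"
    if "Module.submodule H A M" "Module.submodule K A M" for H K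
    using M.submoduleD[OF that(1)] M.submoduleD[OF that(2)] by (intro M.submoduleI) auto
  define R where "R = P \<inter> P'"
  have R: "Module.submodule R A M" unfolding R_def by (rule inter[OF P P'])
  note rr = M.submoduleD[OF R]
  have WR: "\<exists>x\<in>R. W x \<noteq> 0"
    unfolding R_def by (rule dominant_functional_inter[OF M r W P P' WP WP'])
  \<comment> \<open>Otherwise simplicity of \<open>E / K\<close> would give \<open>E = H + K\<close>, and \<open>W\<close> would vanish on \<open>E\<close>.\<close>
  have absorb: "H \<subseteq> K"
    if "Module.submodule E A M" "Module.submodule K A M" "K \<subseteq> E"
      "Y = quotient_module (M\<lparr>carrier := E\<rparr>) K" "simple_module A Y"
      "\<exists>x\<in>E. W x \<noteq> 0" "\<And>x. x \<in> K \<Longrightarrow> W x = 0"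
      "Module.submodule H A M" "H \<subseteq> E" "\<And>x. x \<in> H \<Longrightarrow> W x = 0" for H K E Y
  proof (rule ccontr)
    note hyp = that
    assume "\<not> H \<subseteq> K"
    obtain x where x: "x \<in> E" "W x \<noteq> 0" using hyp(6) by blast
    obtain h where h: "h \<in> H" "x \<ominus>\<^bsub>M\<^esub> h \<in> K"
      using M.simple_subquotient_sum[OF hyp(1-4) _ hyp(8,9) \<open>\<not> H \<subseteq> K\<close> x(1)] hyp(5)
      unfolding simple_module_def by blast
    have "x \<in> carrier M" "h \<in> carrier M"
      using x h M.submoduleD(1)[OF hyp(1)] M.submoduleD(1)[OF hyp(8)] by auto
    hence "W (x \<ominus>\<^bsub>M\<^esub> h) = W x - W h" by (rule linear_on_minus[OF M carr linW])
    thus False using hyp(7)[OF h(2)] hyp(10)[OF h(1)] x(2) by simp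
  qed
  have RQ: "x \<in> Q'" if "x \<in> R" "x \<in> Q" for x
    using absorb[OF P' Q' QP' X' simple' WP' WQ' inter[OF R Q]] WQ that by (auto simp: R_def)
  have RQ': "x \<in> Q" if "x \<in> R" "x \<in> Q'" for x
    using absorb[OF P Q QP X simple WP WQ inter[OF R Q']] WQ' that by (auto simp: R_def)
  have same: "Q +>\<^bsub>M\<^esub> x = Q +>\<^bsub>M\<^esub> y \<longleftrightarrow> Q' +>\<^bsub>M\<^esub> x = Q' +>\<^bsub>M\<^esub> y" if "x \<in> R" "y \<in> R" for x y
  proof -
    have "x \<in> carrier M" "y \<in> carrier M" using that rr(1) by auto
    thus ?thesis
      using M.coset_eq_iff[OF Q] M.coset_eq_iff[OF Q'] RQ RQ' rr(6)[OF that] by blast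
  qed
  have repr: "\<exists>h\<in>R. K +>\<^bsub>M\<^esub> x = K +>\<^bsub>M\<^esub> h"
    if "Module.submodule E A M" "Module.submodule K A M" "K \<subseteq> E"
      "Y = quotient_module (M\<lparr>carrier := E\<rparr>) K" "simple_module A Y" "R \<subseteq> E"
      "\<And>x. x \<in> K \<Longrightarrow> W x = 0" "x \<in> E" for K E Y x
  proof -
    note hyp = that
    have "\<not> R \<subseteq> K" using WR hyp(7) by blast
    then obtain h where h: "h \<in> R" "x \<ominus>\<^bsub>M\<^esub> h \<in> K"
      using M.simple_subquotient_sum[OF hyp(1-4) _ R hyp(6) _ hyp(8)] hyp(5)
      unfolding simple_module_def by blast
    moreover have "x \<in> carrier M" "h \<in> carrier M"
      using hyp(8) h rr(1) M.submoduleD(1)[OF hyp(1)] by auto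
    ultimately show ?thesis using M.coset_eq_iff[OF hyp(2), of x h] by blast
  qed
  have X_R: "carrier X = (\<lambda>x. Q +>\<^bsub>M\<^esub> x) ` R"
  proof
    show "(\<lambda>x. Q +>\<^bsub>M\<^esub> x) ` R \<subseteq> carrier X" by (auto simp: sq(2) R_def)
    show "carrier X \<subseteq> (\<lambda>x. Q +>\<^bsub>M\<^esub> x) ` R"
      using repr[OF P Q QP X simple _ WQ] by (auto simp: sq(2) R_def)
  qed
  have X'_R: "carrier X' = (\<lambda>x. Q' +>\<^bsub>M\<^esub> x) ` R"
  proof
    show "(\<lambda>x. Q' +>\<^bsub>M\<^esub> x) ` R \<subseteq> carrier X'" by (auto simp: sq'(2) R_def)
    show "carrier X' \<subseteq> (\<lambda>x. Q' +>\<^bsub>M\<^esub> x) ` R"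
      using repr[OF P' Q' QP' X' simple' _ WQ'] by (auto simp: sq'(2) R_def)
  qed
  define F where "F Y = Q' +>\<^bsub>M\<^esub> (SOME x. x \<in> R \<and> Y = Q +>\<^bsub>M\<^esub> x)" for Y
  have F: "F (Q +>\<^bsub>M\<^esub> x) = Q' +>\<^bsub>M\<^esub> x" if "x \<in> R" for x
  proof -
    have "(SOME y. y \<in> R \<and> Q +>\<^bsub>M\<^esub> x = Q +>\<^bsub>M\<^esub> y) \<in> R \<and>
        Q +>\<^bsub>M\<^esub> x = Q +>\<^bsub>M\<^esub> (SOME y. y \<in> R \<and> Q +>\<^bsub>M\<^esub> x = Q +>\<^bsub>M\<^esub> y)"
      by (rule someI[of "\<lambda>y. y \<in> R \<and> Q +>\<^bsub>M\<^esub> x = Q +>\<^bsub>M\<^esub> y" x]) (use that in blast)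
    thus ?thesis unfolding F_def using same that by metis
  qed
  have RP: "x \<in> P" "x \<in> P'" if "x \<in> R" for x using that by (auto simp: R_def)
  have "F \<in> module_hom A X X'"
    unfolding module_hom_def
    by (auto simp: X_R X'_R F sq(4,5) sq'(4,5) RP rr(3,4))
  moreover have "bij_betw F (carrier X) (carrier X')"
    unfolding bij_betw_def X_R X'_R inj_on_def by (auto simp: F same image_image)
  ultimately show ?thesis unfolding isomorphic_modules_def by blast
qed

end

section \<open>The left preorder and left cells\<close>

context positively_based_algebra
begin

lemma basis_vector_closed: "i \<in> {1..n} \<Longrightarrow> a i \<in> carrier A"
  using basis_spans(1)[OF vectorspace basis] by auto

lemma linear_on_mult:
  assumes "linear_on \<k> A (carrier A) \<phi>" "y \<in> carrier A"
  shows "linear_on \<k> A (carrier A) (\<lambda>x. \<phi> (y \<otimes> x))" "linear_on \<k> A (carrier A) (\<lambda>x. \<phi> (x \<otimes> y))"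
  using assms by (auto simp: linear_on_def alg.r_distr alg.l_distr smult_mult mult_smult)

lemma linear_on_structure_constants:
  assumes lin: "linear_on \<k> A (carrier A) \<phi>" and ij: "i \<in> {1..n}" "j \<in> {1..n}"
  shows "\<phi> (a i \<otimes> a j) = (\<Sum>k\<in>{1..n}. of_real (\<gamma> i j k) * \<phi> (a k))"
proof -
  have "\<phi> (a i \<otimes> a j) = (\<Sum>k\<in>{1..n}. \<phi> (of_real (\<gamma> i j k) \<odot> a k))"
    unfolding structure_constants[OF ij]
    using ij gamma_scalar basis_vector_closed
    by (intro linear_on_finsum(2)[OF abelian_monoid lin]) (auto intro!: vs.smult_closed)
  also have "\<dots> = (\<Sum>k\<in>{1..n}. of_real (\<gamma> i j k) * \<phi> (a k))"
    using ij gamma_scalar basis_vector_closed by (intro sum.cong refl linear_on_smult[OF lin]) auto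
  finally show ?thesis .
qed

text \<open>
  The basis is indexed from \<open>1\<close>, list positions from \<open>0\<close>; hence the shift by one in the proof.
\<close>

lemma coefficient_functional:
  assumes k: "k \<in> {1..n}"
  obtains e where "linear_on \<k> A (carrier A) e"
    "\<And>j. j \<in> {1..n} \<Longrightarrow> e (a j) = (if j = k then 1 else 0)"
proof -
  let ?bs = "map a [1..<Suc n]"
  have set: "set ?bs = a ` {1..n}" by (auto simp del: upt_Suc)
  have "distinct ?bs" using inj by (simp add: distinct_map atLeastLessThanSuc_atLeastAtMost del: upt_Suc)
  then obtain co where co: "coordinates \<k> A ?bs co"
    using coordinates_exist[OF vectorspace, of ?bs] basis unfolding set by blast
  show thesis
  proof
    show "linear_on \<k> A (carrier A) (\<lambda>x. co x (k - 1))"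
      using k by (intro coordinates_linear[OF co]) auto
    fix j assume j: "j \<in> {1..n}"
    hence "j - 1 < length [1..<Suc n]" "[1..<Suc n] ! (j - 1) = j"
      using nth_upt[of 1 "j - 1" "Suc n"] by auto
    hence "?bs ! (j - 1) = a j" by (simp only: nth_map)
    thus "co (a j) (k - 1) = (if j = k then 1 else 0)"
      using coordinates_basis[OF co, of "k - 1" "j - 1"] j k by (auto simp del: upt_Suc)
  qed
qed

lemma left_le_refl:
  assumes i: "i \<in> {1..n}"
  shows "left_le n \<gamma> i i"
proof -
  obtain e where e: "linear_on \<k> A (carrier A) e" "\<And>j. j \<in> {1..n} \<Longrightarrow> e (a j) = (if j = i then 1 else 0)"
    using coefficient_functional[OF i] by blast
  have one: "1 \<in> {1..n}" using n_pos by simp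
  have "e (a 1 \<otimes> a i) = (\<Sum>k\<in>{1..n}. if k = i then of_real (\<gamma> 1 i k) else 0)"
    unfolding linear_on_structure_constants[OF e(1) one i] by (intro sum.cong refl) (simp add: e(2))
  also have "\<dots> = of_real (\<gamma> 1 i i)" using i by simp
  also have "a 1 \<otimes> a i = a i" unfolding unit using basis_vector_closed[OF i] by simp
  finally have "\<gamma> 1 i i = 1" using e(2)[OF i] by simp
  hence "0 < \<gamma> 1 i i" by simp
  thus ?thesis using i one unfolding left_le_def star_product_def by blast
qed

text \<open>
  If \<open>a\<^sub>j\<close> occurs in \<open>a\<^sub>s a\<^sub>i\<close> and \<open>a\<^sub>k\<close> occurs in \<open>a\<^sub>t a\<^sub>j\<close>, then \<open>a\<^sub>k\<close> occurs in \<open>a\<^sub>t (a\<^sub>s a\<^sub>i)\<close>, since nonnegative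
  coefficients cannot cancel. By associativity it occurs in \<open>(a\<^sub>t a\<^sub>s) a\<^sub>i\<close>, so in some \<open>a\<^sub>u a\<^sub>i\<close>.
\<close>

lemma left_le_trans:
  assumes ijk: "i \<in> {1..n}" "j \<in> {1..n}" "k \<in> {1..n}"
    and le: "left_le n \<gamma> i j" "left_le n \<gamma> j k"
  shows "left_le n \<gamma> i k"
proof (rule ccontr)
  assume "\<not> left_le n \<gamma> i k"
  hence zero: "\<gamma> u i k = 0" if "u \<in> {1..n}" for u
    using that ijk gamma_nonneg[of u i k] by (auto simp: left_le_def star_product_def less_eq_real_def)
  obtain s t where st: "s \<in> {1..n}" "0 < \<gamma> s i j" "t \<in> {1..n}" "0 < \<gamma> t j k"
    using le by (auto simp: left_le_def star_product_def)
  obtain e where e: "linear_on \<k> A (carrier A) e" "\<And>j. j \<in> {1..n} \<Longrightarrow> e (a j) = (if j = k then 1 else 0)"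
    using coefficient_functional[OF ijk(3)] by blast
  have coeff: "e (a l \<otimes> a r) = of_real (\<gamma> l r k)" if "l \<in> {1..n}" "r \<in> {1..n}" for l r
  proof -
    have "e (a l \<otimes> a r) = (\<Sum>q\<in>{1..n}. if q = k then of_real (\<gamma> l r q) else 0)"
      unfolding linear_on_structure_constants[OF e(1) that] by (intro sum.cong refl) (simp add: e(2))
    thus ?thesis using ijk(3) by simp
  qed
  note closed = basis_vector_closed[OF st(1)] basis_vector_closed[OF st(3)] basis_vector_closed[OF ijk(1)]
  have "e (a t \<otimes> (a s \<otimes> a i)) = (\<Sum>l\<in>{1..n}. of_real (\<gamma> s i l) * e (a t \<otimes> a l))"
    by (rule linear_on_structure_constants[OF linear_on_mult(1)[OF e(1) closed(2)] st(1) ijk(1)])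
  also have "\<dots> = of_real (\<Sum>l\<in>{1..n}. \<gamma> s i l * \<gamma> t l k)"
    unfolding of_real_sum by (intro sum.cong refl) (simp add: coeff[OF st(3)])
  finally have 1: "e (a t \<otimes> (a s \<otimes> a i)) = of_real (\<Sum>l\<in>{1..n}. \<gamma> s i l * \<gamma> t l k)" .
  have "e ((a t \<otimes> a s) \<otimes> a i) = (\<Sum>u\<in>{1..n}. of_real (\<gamma> t s u) * e (a u \<otimes> a i))"
    by (rule linear_on_structure_constants[OF linear_on_mult(2)[OF e(1) closed(3)] st(3) st(1)])
  also have "\<dots> = 0" using coeff[OF _ ijk(1)] zero by (intro sum.neutral) auto
  finally have "complex_of_real (\<Sum>l\<in>{1..n}. \<gamma> s i l * \<gamma> t l k) = 0"
    unfolding 1[symmetric] alg.m_assoc[OF closed(2,1,3)] .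
  hence "(\<Sum>l\<in>{1..n}. \<gamma> s i l * \<gamma> t l k) = 0" by (simp only: of_real_eq_0_iff)
  moreover have "0 < (\<Sum>l\<in>{1..n}. \<gamma> s i l * \<gamma> t l k)"
  proof (rule sum_pos2[of _ j])
    show "0 \<le> \<gamma> s i l * \<gamma> t l k" if "l \<in> {1..n}" for l
      using that gamma_nonneg st ijk by (intro mult_nonneg_nonneg) auto
  qed (use st ijk in auto)
  ultimately show False by simp
qed

lemma left_cell_properties:
  assumes "L \<in> left_cells n \<gamma>"
  shows "L \<subseteq> {1..n}" "L \<noteq> {}"
    and "\<And>i j. \<lbrakk>i \<in> L; j \<in> L\<rbrakk> \<Longrightarrow> left_le n \<gamma> i j"
    and "\<And>i j. \<lbrakk>i \<in> L; j \<in> {1..n}; left_le n \<gamma> i j; left_le n \<gamma> j i\<rbrakk> \<Longrightarrow> j \<in> L"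
proof -
  obtain x where x: "x \<in> {1..n}" "L = left_equiv n \<gamma> `` {x}"
    using assms by (auto simp: left_cells_def quotient_def)
  have L: "i \<in> L \<longleftrightarrow> i \<in> {1..n} \<and> left_le n \<gamma> x i \<and> left_le n \<gamma> i x" for i
    using x by (auto simp: left_equiv_def)
  show "L \<subseteq> {1..n}" using L by blast
  show "L \<noteq> {}" using L[of x] x left_le_refl by blast
  show "left_le n \<gamma> i j" if "i \<in> L" "j \<in> L" for i j
    using that L left_le_trans[of i x j] x(1) by blast
  show "j \<in> L" if "i \<in> L" "j \<in> {1..n}" "left_le n \<gamma> i j" "left_le n \<gamma> j i" for i j
    using that L left_le_trans[of x i j] left_le_trans[of j i x] x(1) by blast
qed

lemma mem_upper_cells_iff:
  assumes L: "L \<in> left_cells n \<gamma>"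
  shows "k \<in> upper_cells n \<gamma> L \<longleftrightarrow> k \<in> {1..n} \<and> (\<exists>l\<in>L. left_le n \<gamma> l k)"
proof
  assume "k \<in> upper_cells n \<gamma> L"
  then obtain L' i j where L': "L' \<in> left_cells n \<gamma>" "k \<in> L'" "i \<in> L" "j \<in> L'" "left_le n \<gamma> i j"
    by (auto simp: upper_cells_def cell_le_def)
  note p = left_cell_properties[OF L] and p' = left_cell_properties[OF L'(1)]
  have "left_le n \<gamma> i k"
    using left_le_trans[of i j k] L' p(1) p'(1) p'(3)[of j k] by blast
  thus "k \<in> {1..n} \<and> (\<exists>l\<in>L. left_le n \<gamma> l k)" using L' p'(1) by blast
next
  assume k: "k \<in> {1..n} \<and> (\<exists>l\<in>L. left_le n \<gamma> l k)"
  have "left_equiv n \<gamma> `` {k} \<in> left_cells n \<gamma>"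
    using k by (auto simp: left_cells_def quotient_def)
  moreover have "k \<in> left_equiv n \<gamma> `` {k}" using k left_le_refl by (auto simp: left_equiv_def)
  ultimately show "k \<in> upper_cells n \<gamma> L"
    using k unfolding upper_cells_def cell_le_def by blast
qed

section \<open>Cell modules\<close>

lemma basis_span_subspace:
  assumes "J \<subseteq> {1..n}"
  shows "submodule (scalars \<k>) (basis_span \<k> A a J) A" "a ` J \<subseteq> basis_span \<k> A a J"
proof -
  have "a ` J \<subseteq> carrier A" using assms basis_vector_closed by blast
  thus "submodule (scalars \<k>) (basis_span \<k> A a J) A" "a ` J \<subseteq> basis_span \<k> A a J"
    unfolding basis_span_def by (rule vs.span_is_submodule, rule vs.in_own_span)
qed

text \<open>
  Two span inductions: left multiplication by a basis element preserves the span of an upward closed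
  set, and the elements of the algebra that map a given vector into the span form a subspace.
\<close>

lemma basis_span_submodule:
  assumes J: "J \<subseteq> {1..n}"
    and up: "\<And>j k. \<lbrakk>j \<in> J; k \<in> {1..n}; left_le n \<gamma> j k\<rbrakk> \<Longrightarrow> k \<in> J"
  shows "Module.submodule (basis_span \<k> A a J) A (regular_module A)"
proof -
  let ?S = "basis_span \<k> A a J"
  interpret S: submodule "scalars \<k>" ?S A by (rule basis_span_subspace(1)[OF J])
  interpret reg: left_module A "regular_module A" by (rule regular_left_module[OF ring])
  have basis_mult: "a s \<otimes> a j \<in> ?S" if s: "s \<in> {1..n}" and j: "j \<in> J" for s j
  proof -
    have jn: "j \<in> {1..n}" using j J by blast
    \<comment> \<open>A summand outside the span of \<open>J\<close> has coefficient zero.\<close>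
    have "of_real (\<gamma> s j k) \<odot> a k \<in> ?S" if k: "k \<in> {1..n}" for k
    proof (cases "0 < \<gamma> s j k")
      case True
      hence "left_le n \<gamma> j k" using s k unfolding left_le_def star_product_def by blast
      hence "k \<in> J" by (rule up[OF j k])
      thus ?thesis
        using basis_span_subspace(2)[OF J] gamma_scalar[OF s jn k] by (intro S.smult_closed) auto
    next
      case False
      hence "\<gamma> s j k = 0" using gamma_nonneg[OF s jn k] by simp
      moreover have "0 \<odot> a k = \<zero>" using vs.lmult_0[OF basis_vector_closed[OF k]] by simp
      ultimately show ?thesis using S.zero_closed by simp
    qed
    thus ?thesis
      unfolding structure_constants[OF s jn] using S.subset S.zero_closed S.m_closed
      by (intro linear_on_finsum(1)[OF abelian_monoid, where \<phi> = "\<lambda>_. 0" and \<k> = "{}"])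
        (auto simp: linear_on_def)
  qed
  have left: "a s \<otimes> x \<in> ?S" if s: "s \<in> {1..n}" and x: "x \<in> ?S" for s x
  proof -
    let ?T = "{x \<in> carrier A. a s \<otimes> x \<in> ?S}"
    have as: "a s \<in> carrier A" by (rule basis_vector_closed[OF s])
    have "submodule (scalars \<k>) ?T A"
      using as vs.module_axioms mult_smult by (auto simp: submodule_def alg.r_distr)
    moreover have "a ` J \<subseteq> ?T" using basis_mult[OF s] basis_vector_closed J by blast
    ultimately have "?S \<subseteq> ?T" unfolding basis_span_def by (intro vs.span_is_subset)
    thus ?thesis using x by blast
  qed
  have mult: "y \<otimes> x \<in> ?S" if y: "y \<in> carrier A" and x: "x \<in> ?S" for y x
  proof -
    let ?T = "{y \<in> carrier A. y \<otimes> x \<in> ?S}"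
    have xA: "x \<in> carrier A" using S.subset x by blast
    have "submodule (scalars \<k>) ?T A"
      using xA vs.module_axioms smult_mult by (auto simp: submodule_def alg.l_distr)
    moreover have "a ` {1..n} \<subseteq> ?T" using left x basis_vector_closed by blast
    ultimately have "carrier A \<subseteq> ?T"
      unfolding basis_spans(2)[OF vectorspace basis, symmetric] by (intro vs.span_is_subset)
    thus ?thesis using y by blast
  qed
  show ?thesis
  proof (rule reg.submoduleI)
    show "?S \<subseteq> carrier (regular_module A)" using S.subset by (simp add: regular_module_def)
    show "\<zero>\<^bsub>regular_module A\<^esub> \<in> ?S" using S.zero_closed by (simp add: regular_module_def)
    show "x \<oplus>\<^bsub>regular_module A\<^esub> y \<in> ?S" if "x \<in> ?S" "y \<in> ?S" for x y
      using S.m_closed[OF that] by (simp add: regular_module_def)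
    show "y \<odot>\<^bsub>regular_module A\<^esub> x \<in> ?S" if "y \<in> carrier A" "x \<in> ?S" for x y
      using mult[OF that] by (simp add: regular_module_def)
  qed
qed

lemma cell_submodules:
  assumes L: "L \<in> left_cells n \<gamma>"
  defines "M \<equiv> basis_span \<k> A a (upper_cells n \<gamma> L)"
    and "N \<equiv> basis_span \<k> A a (upper_cells n \<gamma> L - L)"
  shows "Module.submodule M A (regular_module A)" "Module.submodule N A (regular_module A)" "N \<subseteq> M"
proof -
  note p = left_cell_properties[OF L] and U = mem_upper_cells_iff[OF L]
  have sub: "upper_cells n \<gamma> L \<subseteq> {1..n}" using U by blast
  have up: "k \<in> upper_cells n \<gamma> L"
    if jk: "j \<in> upper_cells n \<gamma> L" "k \<in> {1..n}" "left_le n \<gamma> j k" for j k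
  proof -
    obtain l where l: "l \<in> L" "left_le n \<gamma> l j" "j \<in> {1..n}" using jk(1) U by blast
    have "left_le n \<gamma> l k" using left_le_trans[OF _ l(3) jk(2) l(2) jk(3)] l(1) p(1) by blast
    thus ?thesis using U l(1) jk(2) by blast
  qed
  show "Module.submodule M A (regular_module A)"
    unfolding M_def by (rule basis_span_submodule[OF sub up])
  show "Module.submodule N A (regular_module A)"
    unfolding N_def
  proof (rule basis_span_submodule)
    show "upper_cells n \<gamma> L - L \<subseteq> {1..n}" using sub by blast
    fix j k assume j: "j \<in> upper_cells n \<gamma> L - L" and k: "k \<in> {1..n}" and jk: "left_le n \<gamma> j k"
    have "k \<notin> L"
    proof
      assume kL: "k \<in> L"
      obtain l where l: "l \<in> L" "left_le n \<gamma> l j" "j \<in> {1..n}" using j U by blast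
      have "left_le n \<gamma> k j" using left_le_trans[of k l j] p(1) p(3)[OF kL l(1)] l k by blast
      hence "j \<in> L" using p(4)[OF kL l(3) _ jk] by blast
      thus False using j by blast
    qed
    thus "k \<in> upper_cells n \<gamma> L - L" using up j k jk by blast
  qed
  show "N \<subseteq> M" unfolding M_def N_def basis_span_def by (intro vs.span_is_monotone) blast
qed

lemma cell_left_module:
  assumes "L \<in> left_cells n \<gamma>"
  shows "left_module A (cell_module \<k> A n a \<gamma> L)"
proof -
  interpret reg: left_module A "regular_module A" by (rule regular_left_module[OF ring])
  show ?thesis
    unfolding cell_module_def by (rule reg.subquotient_simps(1)[OF cell_submodules[OF assms] refl])
qed

lemma positive_element_closed:
  assumes "\<And>i. i \<in> {1..n} \<Longrightarrow> complex_of_real (c i) \<in> \<k>"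
  shows "positive_element A n a c \<in> carrier A"
  unfolding positive_element_def
  using assms basis_vector_closed by (intro abelian_monoid.finsum_closed[OF abelian_monoid]) (auto intro!: vs.smult_closed)

text \<open>
  Modulo the span of the strictly larger cells, \<open>a\<^sub>s a\<^sub>l\<close> for \<open>l \<in> L\<close> keeps exactly its terms in \<open>L\<close>, since
  all its terms lie above \<open>L\<close>. The entry is read off by the linear map sending \<open>y\<close> to the \<open>i\<close>-th
  coordinate of the class of \<open>y a\<^sub>l\<close>, where \<open>l\<close> is the \<open>j\<close>-th element of \<open>L\<close>.
\<close>

lemma cell_matrix_entry:
  assumes L: "L \<in> left_cells n \<gamma>"
    and c: "\<And>i. i \<in> {1..n} \<Longrightarrow> complex_of_real (c i) \<in> \<k>"
    and D: "action_matrix \<k> A (cell_module \<k> A n a \<gamma> L) (cell_basis \<k> A n a \<gamma> L)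
      (positive_element A n a c) D"
    and ij: "i < card L" "j < card L"
  shows "D $$ (i, j) = complex_of_real
    (\<Sum>s\<in>{1..n}. c s * \<gamma> s (sorted_list_of_set L ! j) (sorted_list_of_set L ! i))"
proof -
  interpret reg: left_module A "regular_module A" by (rule regular_left_module[OF ring])
  let ?C = "cell_module \<k> A n a \<gamma> L" and ?bs = "cell_basis \<k> A n a \<gamma> L"
  define l where "l i = sorted_list_of_set L ! i" for i
  define U where "U = upper_cells n \<gamma> L"
  define M where "M = basis_span \<k> A a U"
  define N where "N = basis_span \<k> A a (U - L)"
  note sub = cell_submodules[OF L, folded U_def, folded M_def N_def]
  have CX: "?C = quotient_module ((regular_module A)\<lparr>carrier := M\<rparr>) N"
    by (simp add: cell_module_def U_def M_def N_def)
  note sq = reg.subquotient_simps[OF sub CX]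
  have coset: "H +>\<^bsub>regular_module A\<^esub> x = H +> x" for H x
    by (simp add: a_r_coset_def r_coset_def regular_module_def)
  interpret N: abelian_subgroup N "regular_module A" by (rule reg.submodule_abelian_subgroup[OF sub(2)])
  interpret C: left_module A ?C by (rule sq(1))
  have Ln: "L \<subseteq> {1..n}" by (rule left_cell_properties(1)[OF L])
  hence finL: "finite L" by (rule finite_subset) simp
  have Un: "U \<subseteq> {1..n}" unfolding U_def using mem_upper_cells_iff[OF L] by blast
  have LU: "L \<subseteq> U" unfolding U_def using mem_upper_cells_iff[OF L] Ln left_le_refl by blast
  have len: "length ?bs = card L" by (simp add: cell_basis_def)
  have lL: "l q \<in> L" if "q < card L" for q
    using that nth_mem[of q "sorted_list_of_set L"] finL by (simp add: l_def)
  have bs: "?bs ! q = N +> a (l q)" if "q < card L" for q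
    using that by (simp add: cell_basis_def N_def U_def l_def)
  have aM: "a k \<in> M" if "k \<in> U" for k
    using basis_span_subspace(2)[OF Un] that by (auto simp: M_def)
  have aN: "N +> a k = N" if "k \<in> U" "k \<notin> L" for k
  proof -
    have "a k \<in> N"
      using basis_span_subspace(2)[of "U - L"] Un that by (auto simp: N_def)
    thus ?thesis using N.a_rcos_const[of "a k"] by (simp add: coset)
  qed
  have ob: "distinct ?bs" "vectorspace.basis (scalars \<k>) (underlying_space A ?C) (set ?bs)"
    using D unfolding action_matrix_def ordered_basis_def by blast+
  obtain co where co: "coordinates \<k> (underlying_space A ?C) ?bs co"
    using coordinates_exist[OF underlying_vectorspace[OF sq(1)] ob] .
  have ij': "i < length ?bs" "j < length ?bs" using ij len by auto
  have lco: "linear_on \<k> (underlying_space A ?C) (carrier ?C) (\<lambda>x. co x i)"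
    using coordinates_linear[OF co ij'(1)] by simp
  interpret M: submodule "scalars \<k>" M A unfolding M_def by (rule basis_span_subspace(1)[OF Un])
  define \<phi> where "\<phi> x = co (N +> x) i" for x
  have inC: "N +> x \<in> carrier ?C" if "x \<in> M" for x
    using that by (simp add: sq(2) coset)
  have lin: "linear_on \<k> A M \<phi>"
    unfolding linear_on_def
  proof (intro conjI ballI)
    fix x y assume x: "x \<in> M" and y: "y \<in> M"
    have "N +> (x \<oplus> y) = (N +> x) \<oplus>\<^bsub>?C\<^esub> (N +> y)"
      using sq(4)[OF x y] by (simp add: coset) (simp add: regular_module_def)
    thus "\<phi> (x \<oplus> y) = \<phi> x + \<phi> y"
      using linear_on_add[OF lco, of "N +> x" "N +> y"] inC[OF x] inC[OF y] by (simp add: \<phi>_def)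
  next
    fix \<kappa> x assume \<kappa>: "\<kappa> \<in> \<k>" and x: "x \<in> M"
    have "N +> (\<kappa> \<odot> x) = (\<kappa> \<odot> \<one>) \<odot>\<^bsub>?C\<^esub> (N +> x)"
      using sq(5)[OF scalar_one_closed[OF \<kappa>] x] scalar_one_mult[OF \<kappa>, of x] x M.subset
      by (simp add: coset subset_iff) (simp add: regular_module_def)
    thus "\<phi> (\<kappa> \<odot> x) = \<kappa> * \<phi> x"
      using linear_on_smult[OF lco \<kappa>, of "N +> x"] inC[OF x] by (simp add: \<phi>_def)
  qed
  have \<phi>_basis: "\<phi> (a k) = (if k = l i then 1 else 0)" if k: "k \<in> U" for k
  proof (cases "k \<in> L")
    case True
    then obtain q where q: "q < card L" "k = l q"
      using finL unfolding l_def by (metis in_set_conv_nth length_sorted_list_of_set set_sorted_list_of_set)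
    have "l q = l i \<longleftrightarrow> q = i"
      using q ij finL unfolding l_def by (simp add: nth_eq_iff_index_eq)
    thus ?thesis
      using coordinates_basis[OF co ij'(1), of q] q len bs[OF q(1)] by (simp add: \<phi>_def)
  next
    case False
    have "\<phi> (a k) = co \<zero>\<^bsub>?C\<^esub> i" using aN[OF k False] by (simp add: \<phi>_def sq(3))
    also have "\<dots> = 0" using linear_on_add[OF lco, of "\<zero>\<^bsub>?C\<^esub>" "\<zero>\<^bsub>?C\<^esub>"] by simp
    finally show ?thesis using False lL[OF ij(1)] by auto
  qed
  have lj: "l j \<in> {1..n}" "l j \<in> U" "l i \<in> {1..n}" using lL[OF ij(1)] lL[OF ij(2)] Ln LU by blast+
  have alj: "a (l j) \<in> carrier A" "a (l j) \<in> M" using basis_vector_closed[OF lj(1)] aM[OF lj(2)] by auto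
  have mult: "y \<otimes> x \<in> M" if "y \<in> carrier A" "x \<in> M" for x y
    using reg.submoduleD(4)[OF sub(1) that] by (simp add: regular_module_def)
  define \<psi> where "\<psi> y = \<phi> (y \<otimes> a (l j))" for y
  have lin\<psi>: "linear_on \<k> A (carrier A) \<psi>"
    using linear_on_add[OF lin] linear_on_smult[OF lin] mult alj
    by (simp add: linear_on_def \<psi>_def alg.l_distr smult_mult)
  have \<psi>_basis: "\<psi> (a s) = of_real (\<gamma> s (l j) (l i))" if s: "s \<in> {1..n}" for s
  proof -
    have inM: "of_real (\<gamma> s (l j) k) \<odot> a k \<in> M"
      and val: "\<phi> (of_real (\<gamma> s (l j) k) \<odot> a k) = (if k = l i then of_real (\<gamma> s (l j) k) else 0)"
      if k: "k \<in> {1..n}" for k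
    proof -
      have \<kappa>: "of_real (\<gamma> s (l j) k) \<in> \<k>" by (rule gamma_scalar[OF s lj(1) k])
      have "of_real (\<gamma> s (l j) k) \<odot> a k \<in> M \<and>
          \<phi> (of_real (\<gamma> s (l j) k) \<odot> a k) = (if k = l i then of_real (\<gamma> s (l j) k) else 0)"
      proof (cases "0 < \<gamma> s (l j) k")
        case True
        hence "left_le n \<gamma> (l j) k" using s k unfolding left_le_def star_product_def by blast
        hence kU: "k \<in> U" unfolding U_def using mem_upper_cells_iff[OF L] lL[OF ij(2)] k by blast
        thus ?thesis
          using aM[OF kU] \<kappa> M.smult_closed linear_on_smult[OF lin \<kappa> aM[OF kU]] \<phi>_basis[OF kU] by simp
      next
        case False
        hence 0: "\<gamma> s (l j) k = 0" using gamma_nonneg[OF s lj(1) k] by simp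
        have "0 \<odot> a k = \<zero>" using vs.lmult_0[OF basis_vector_closed[OF k]] by simp
        moreover have "\<phi> \<zero> = 0" using linear_on_add[OF lin M.zero_closed M.zero_closed] by simp
        ultimately show ?thesis using 0 M.zero_closed by auto
      qed
      thus "of_real (\<gamma> s (l j) k) \<odot> a k \<in> M"
        "\<phi> (of_real (\<gamma> s (l j) k) \<odot> a k) = (if k = l i then of_real (\<gamma> s (l j) k) else 0)" by auto
    qed
    have "\<psi> (a s) = (\<Sum>k\<in>{1..n}. \<phi> (of_real (\<gamma> s (l j) k) \<odot> a k))"
      unfolding \<psi>_def structure_constants[OF s lj(1)] using M.subset M.zero_closed M.m_closed inM
      by (intro linear_on_finsum(2)[OF abelian_monoid lin]) auto
    also have "\<dots> = (\<Sum>k\<in>{1..n}. if k = l i then of_real (\<gamma> s (l j) k) else 0)"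
      by (intro sum.cong refl val)
    also have "\<dots> = of_real (\<gamma> s (l j) (l i))" using lj(3) by simp
    finally show ?thesis .
  qed
  have rA: "positive_element A n a c \<in> carrier A" by (rule positive_element_closed[OF c])
  have "\<psi> (positive_element A n a c) = (\<Sum>s\<in>{1..n}. \<psi> (of_real (c s) \<odot> a s))"
    unfolding positive_element_def using c basis_vector_closed
    by (intro linear_on_finsum(2)[OF abelian_monoid lin\<psi>]) (auto intro!: vs.smult_closed)
  also have "\<dots> = (\<Sum>s\<in>{1..n}. of_real (c s * \<gamma> s (l j) (l i)))"
    using c basis_vector_closed
    by (intro sum.cong refl) (simp add: linear_on_smult[OF lin\<psi>] \<psi>_basis)
  finally have entry: "\<psi> (positive_element A n a c) = of_real (\<Sum>s\<in>{1..n}. c s * \<gamma> s (l j) (l i))" by simp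
  have bj: "?bs ! j \<in> carrier ?C" using bs[OF ij(2)] inC[OF alj(2)] by simp
  have "\<psi> (positive_element A n a c) = co (positive_element A n a c \<odot>\<^bsub>?C\<^esub> ?bs ! j) i"
    using sq(5)[OF rA alj(2)] bs[OF ij(2)]
    by (simp add: \<psi>_def \<phi>_def coset) (simp add: regular_module_def)
  also have "\<dots> = (\<Sum>k<length ?bs. D $$ (i, k) * co (?bs ! j) k)"
    by (rule action_in_coordinates[OF sq(1) rA D co bj ij'(1)])
  also have "\<dots> = (\<Sum>k<length ?bs. if k = j then D $$ (i, k) else 0)"
    using ij' by (intro sum.cong refl) (simp add: coordinates_basis[OF co])
  also have "\<dots> = D $$ (i, j)" using ij' by simp
  finally show ?thesis using entry by (simp add: l_def)
qed

text \<open>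
  Within a left cell any two indices are related by a single structure constant.
\<close>

lemma cell_matrix_positive:
  assumes L: "L \<in> left_cells n \<gamma>" and c: "\<And>i. i \<in> {1..n} \<Longrightarrow> 0 < c i"
    and ij: "i < card L" "j < card L"
  shows "0 < (\<Sum>s\<in>{1..n}. c s * \<gamma> s (sorted_list_of_set L ! j) (sorted_list_of_set L ! i))"
proof -
  note p = left_cell_properties[OF L]
  have finL: "finite L" using p(1) by (rule finite_subset) simp
  let ?l = "\<lambda>i. sorted_list_of_set L ! i"
  have l: "?l i \<in> L" "?l j \<in> L"
    using ij finL nth_mem[of _ "sorted_list_of_set L"] by auto
  obtain s where s: "s \<in> {1..n}" "0 < \<gamma> s (?l j) (?l i)"
    using p(3)[OF l(2,1)] by (auto simp: left_le_def star_product_def)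
  show ?thesis
  proof (rule sum_pos2[of _ s])
    show "0 \<le> c t * \<gamma> t (?l j) (?l i)" if "t \<in> {1..n}" for t
    proof -
      have "?l i \<in> {1..n}" "?l j \<in> {1..n}" using l p(1) by blast+
      thus ?thesis using c[OF that] gamma_nonneg[OF that] by simp
    qed
  qed (use s c[OF s(1)] in auto)
qed

end

section \<open>Independence of the coefficients\<close>

theorem theorem5:
  fixes \<k> :: "complex set" and A :: "(complex, 'a) module" and n :: nat
    and a :: "nat \<Rightarrow> 'a" and \<gamma> :: "nat \<Rightarrow> nat \<Rightarrow> nat \<Rightarrow> real"
    and L :: "nat set" and c c' :: "nat \<Rightarrow> real" and X X' :: "('a, 'a set set) module"
  assumes "positively_based_algebra \<k> A n a \<gamma>"
    and "L \<in> left_cells n \<gamma>"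
    and "\<And>i. i \<in> {1..n} \<Longrightarrow> 0 < c i \<and> complex_of_real (c i) \<in> \<k>"
    and "\<And>i. i \<in> {1..n} \<Longrightarrow> 0 < c' i \<and> complex_of_real (c' i) \<in> \<k>"
    and "special_subquotient \<k> A n a \<gamma> L c X"
    and "special_subquotient \<k> A n a \<gamma> L c' X'"
  shows "isomorphic_modules A X X'"
proof -
  interpret positively_based_algebra \<k> A n a \<gamma> by fact
  let ?C = "cell_module \<k> A n a \<gamma> L" and ?bs = "cell_basis \<k> A n a \<gamma> L"
  let ?r = "positive_element A n a c" and ?r' = "positive_element A n a c'"
  note L = assms(2)
  have C: "left_module A ?C" by (rule cell_left_module[OF L])
  have len: "length ?bs = card L" by (simp add: cell_basis_def)
  have r: "?r \<in> carrier A" "?r' \<in> carrier A"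
    using assms(3,4) by (auto intro: positive_element_closed)
  obtain P Q where PQ: "Module.submodule P A ?C" "Module.submodule Q A ?C" "Q \<subseteq> P"
    "X = quotient_module (?C\<lparr>carrier := P\<rparr>) Q"
    using assms(5) unfolding special_subquotient_def subquotient_def by blast
  obtain P' Q' where PQ': "Module.submodule P' A ?C" "Module.submodule Q' A ?C" "Q' \<subseteq> P'"
    "X' = quotient_module (?C\<lparr>carrier := P'\<rparr>) Q'"
    using assms(6) unfolding special_subquotient_def subquotient_def by blast
  have simple: "simple_module A X" "simple_module A X'"
    using assms(5,6) unfolding special_subquotient_def by blast+
  obtain D \<mu> where D: "action_matrix \<k> A ?C ?bs ?r D" "perron_frobenius_eigenvalue D \<mu>"
    "action_eigenvalue \<k> A X ?r (complex_of_real \<mu>)"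
    using assms(5) unfolding special_subquotient_def by blast
  obtain D' \<mu>' where D': "action_matrix \<k> A ?C ?bs ?r' D'" "perron_frobenius_eigenvalue D' \<mu>'"
    "action_eigenvalue \<k> A X' ?r' (complex_of_real \<mu>')"
    using assms(6) unfolding special_subquotient_def by blast
  have ob: "distinct ?bs" "vectorspace.basis (scalars \<k>) (underlying_space A ?C) (set ?bs)"
    using D(1) unfolding action_matrix_def ordered_basis_def by blast+
  obtain co where co: "coordinates \<k> (underlying_space A ?C) ?bs co"
    using coordinates_exist[OF underlying_vectorspace[OF C] ob] .
  let ?d = "\<lambda>c i j. \<Sum>s\<in>{1..n}. c s * \<gamma> s (sorted_list_of_set L ! j) (sorted_list_of_set L ! i)"
  have d: "D $$ (i, j) = complex_of_real (?d c i j)" "0 < ?d c i j"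
    "D' $$ (i, j) = complex_of_real (?d c' i j)" "0 < ?d c' i j"
    if "i < length ?bs" "j < length ?bs" for i j
    using that assms(3,4) cell_matrix_entry[OF L _ D(1)] cell_matrix_entry[OF L _ D'(1)]
      cell_matrix_positive[OF L, of c] cell_matrix_positive[OF L, of c'] unfolding len by blast+
  define W where "W w x = (\<Sum>i<length ?bs. of_real (w i) * co x i)" for w :: "nat \<Rightarrow> real" and x
  obtain w where w: "\<And>i. i < length ?bs \<Longrightarrow> 0 < w i"
    "dominant_functional ?C ?r (of_real \<mu>) (W w)"
    "\<And>P g x. \<lbrakk>Module.submodule P A ?C; \<And>i. i < length ?bs \<Longrightarrow> 0 < g i; \<And>x. x \<in> P \<Longrightarrow> W g x = 0; x \<in> P\<rbrakk>
      \<Longrightarrow> W w x = 0"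
    using perron_functional[OF C r(1) D(1) co d(1,2) D(2)] unfolding W_def by blast
  obtain w' where w': "\<And>i. i < length ?bs \<Longrightarrow> 0 < w' i"
    "dominant_functional ?C ?r' (of_real \<mu>') (W w')"
    "\<And>P g x. \<lbrakk>Module.submodule P A ?C; \<And>i. i < length ?bs \<Longrightarrow> 0 < g i; \<And>x. x \<in> P \<Longrightarrow> W g x = 0; x \<in> P\<rbrakk>
      \<Longrightarrow> W w' x = 0"
    using perron_functional[OF C r(2) D'(1) co d(3,4) D'(2)] unfolding W_def by blast
  note special = dominant_functional_on_subquotient[OF C r(1) w(2) PQ D(3)]
  note special' = dominant_functional_on_subquotient[OF C r(2) w'(2) PQ' D'(3)]
  \<comment> \<open>The subquotient \<open>X'\<close> is special for \<open>c'\<close>; positivity carries its criterion over to the functional of \<open>c\<close>.\<close>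
  have Q': "W w x = 0" if "x \<in> Q'" for x
    by (rule w(3)[OF PQ'(2) _ _ that, of w']) (use w'(1) special'(1) in auto)
  have P': "\<exists>x\<in>P'. W w x \<noteq> 0"
  proof (rule ccontr)
    assume "\<not> ?thesis"
    hence "W w' x = 0" if "x \<in> P'" for x
      by (intro w'(3)[OF PQ'(1) _ _ that, of w]) (use w(1) in auto)
    thus False using special'(2) by blast
  qed
  show ?thesis
    by (rule special_subquotients_isomorphic[OF C r(1) w(2) PQ simple(1) special(2,1) PQ' simple(2) P' Q'])
qed

end
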